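(* Let $\{\mathcal A,\mathcal B,\mathcal C\}\in\mathcal G_n$, and let $v$ be the pseudo-exponential potential recovered from $\{\mathcal A,\mathcal B,\mathcal C\}$ by the recovery procedure described in the context (with the choice of the positive solution $X$ of the Riccati equation for which $\sigma(\mathcal A+\mathrm i\mathcal B\mathcal B^*X)\subset\mathbb C_-\cup\mathbb R$). Then this procedure is stable at $\{\mathcal A,\mathcal B,\mathcal C\}$: for every $\varepsilon>0$ there is $\delta>0$ such that for each triple $\{\widetilde{\mathcal A},\widetilde{\mathcal B},\widetilde{\mathcal C}\}\in\mathcal G_n$ with $$\|\mathcal A-\widetilde{\mathcal A}\|+\|\mathcal B-\widetilde{\mathcal B}\|+\|\mathcal C-\widetilde{\mathcal C}\|<\delta,$$ the potential $\widetilde v$ recovered by the same procedure from $\{\widetilde{\mathcal A},\widetilde{\mathcal B},\widetilde{\mathcal C}\}$ satisfies $$\sup_{x\in[0,\infty)}\|v(x)-\widetilde v(x)\|<\varepsilon .$$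
   Context: Fix positive integers $m_1,m_2,n$ and put $m=m_1+m_2$. $\|\cdot\|$ is the $l^2$-induced (operator) norm of a matrix, $\sigma(\cdot)$ is the spectrum, $\mathbb C_\pm$ are the open upper/lower half-planes, and $X>0$ means that $X$ is Hermitian with all eigenvalues positive. A matrix function $\varphi$ is contractive on a set if $\varphi(z)^*\varphi(z)\le I$ for all $z$ in that set. Class $\mathcal G_n$: the set of triples $\{\mathcal A,\mathcal B,\mathcal C\}$ of complex matrices of sizes $n\times n$, $n\times m_1$, $m_2\times n$, respectively, such that $\varphi(z)=\mathcal C(zI_n-\mathcal A)^{-1}\mathcal B$ is a minimal realization (i.e. $\sum_{k=0}^{n-1}\operatorname{Im}\mathcal A^k\mathcal B=\mathbb C^n$ and $\sum_{k=0}^{n-1}\operatorname{Im}(\mathcal A^* )^k\mathcal C^*=\mathbb C^n$, where $\operatorname{Im}$ is the image) of an $m_2\times m_1$ matrix function $\varphi$ which is contractive on $\mathbb R\cup\mathbb C_+$. Known fact: for $\{\mathcal A,\mathcal B,\mathcal C\}\in\mathcal G_n$ there is a unique Hermitian solution $X$ of the Riccati equation $$X\mathcal B\mathcal B^*X+\mathrm i(\mathcal A^*X-X\mathcal A)+\mathcal C^*\mathcal C=0$$ such that $\sigma(\mathcal A+\mathrm i\mathcal B\mathcal B^*X)\subset\mathbb C_-\cup\mathbb R$, and this $X$ is positive. Recovery procedure: given $\{\mathcal A,\mathcal B,\mathcal C\}\in\mathcal G_n$, take this solution $X>0$ and set $$\alpha=\mathcal A+\mathrm i\mathcal B\mathcal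 B^*X,\quad S_0=X^{-1},\quad \vartheta_1=\mathcal B,\quad \vartheta_2=-\mathrm iX^{-1}\mathcal C^*,$$ $$\Lambda(x)=\begin{bmatrix}\mathrm e^{-\mathrm ix\alpha}\vartheta_1 & \mathrm e^{\mathrm ix\alpha}\vartheta_2\end{bmatrix},\quad S(x)=S_0+\int_0^x\Lambda(t)\Lambda(t)^*\,dt,\quad v(x)=-2\mathrm i\,\vartheta_1^*\mathrm e^{\mathrm ix\alpha^*}S(x)^{-1}\mathrm e^{\mathrm ix\alpha}\vartheta_2\quad(x\ge0).$$ The $m_1\times m_2$ matrix function $v$ is the recovered potential. Background facts: the identity $\alpha S_0-S_0\alpha^*=\mathrm i(\vartheta_1\vartheta_1^*-\vartheta_2\vartheta_2^* )$ holds, and $\varphi$ is the Weyl function of the Dirac system $y'(x,z)=\mathrm i(zj+jV(x))y(x,z)$, $x\ge0$, with $j=\operatorname{diag}\{I_{m_1},-I_{m_2}\}$ and $V=\begin{bmatrix} 0 & v \\ {v^*} & 0 \end{bmatrix}$. This means that $\int_0^\infty\begin{bmatrix}I_{m_1}&\varphi(z)^*\end{bmatrix}Y(x,z)^*Y(x,z)\begin{bmatrix}I_{m_1}\\ \varphi(z)\end{bmatrix}dx<\infty$ for $z\in\mathbb C_+$, where $Y$ is the fundamental solution with $Y(0,z)=I_m$. Moreover, $v$ is the only locally square summable potential whose Dirac system has Weyl function $\varphi$. *)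

theory Defs
  imports "HOL-Analysis.Analysis"
begin

text \<open>
  A complex matrix with rows indexed by 'a and columns indexed by 'b has type complex^'b^'a.
  The sizes n, m1, m2 are the cardinalities of the index types 'n, 'm1, 'm2.
\<close>

definition smul :: "complex \<Rightarrow> complex^'b^'a \<Rightarrow> complex^'b^'a"  (infixr "*\<^sub>C" 75) where
  "c *\<^sub>C M = (\<chi> i j. c * M $ i $ j)"

definition cadj :: "complex^'b^'a \<Rightarrow> complex^'a^'b" where
  "cadj M = (\<chi> i j. cnj (M $ j $ i))"

text \<open>The power operator on the vector type is componentwise, hence a separate matrix power.\<close>

primrec matpow :: "complex^'n^'n \<Rightarrow> nat \<Rightarrow> complex^'n^'n" where
  "matpow M 0 = mat 1"
| "matpow M (Suc k) = M ** matpow M k"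

definition matexp :: "complex^'n^'n \<Rightarrow> complex^'n^'n" where
  "matexp M = (\<Sum>k. (1 / fact k) *\<^sub>R matpow M k)"

text \<open>
  Operator norm induced by the l2 norms. (The type-class norm of a matrix is the Frobenius norm.)
\<close>

definition opnorm :: "complex^'b^'a \<Rightarrow> real" where
  "opnorm M = onorm (\<lambda>x. M *v x)"

definition spectrum :: "complex^'n^'n \<Rightarrow> complex set" where
  "spectrum M = {\<mu>. \<not> invertible (mat \<mu> - M)}"

definition hermitian :: "complex^'n^'n \<Rightarrow> bool" where
  "hermitian M \<longleftrightarrow> cadj M = M"

definition pos_def :: "complex^'n^'n \<Rightarrow> bool" where
  "pos_def M \<longleftrightarrow> hermitian M \<and> (\<forall>\<mu>\<in>spectrum M. \<mu> \<in> \<real> \<and> 0 < Re \<mu>)"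

definition pos_semidef :: "complex^'n^'n \<Rightarrow> bool" where
  "pos_semidef M \<longleftrightarrow> hermitian M \<and> (\<forall>\<mu>\<in>spectrum M. \<mu> \<in> \<real> \<and> 0 \<le> Re \<mu>)"

definition contractive_on :: "complex set \<Rightarrow> (complex \<Rightarrow> complex^'m1^'m2) \<Rightarrow> bool" where
  "contractive_on D \<phi> \<longleftrightarrow> (\<forall>z\<in>D. pos_semidef (mat 1 - cadj (\<phi> z) ** \<phi> z))"

definition hcat :: "complex^'b^'a \<Rightarrow> complex^'c^'a \<Rightarrow> complex^('b + 'c)^'a" where
  "hcat M N = (\<chi> i j. case j of Inl k \<Rightarrow> M $ i $ k | Inr l \<Rightarrow> N $ i $ l)"

definition realization ::
  "complex^'n^'n \<Rightarrow> complex^'m1^'n \<Rightarrow> complex^'n^'m2 \<Rightarrow> complex \<Rightarrow> complex^'m1^'m2" where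
  "realization A B C z = C ** matrix_inv (mat z - A) ** B"

text \<open>The sums below are sums of subspaces (elementwise addition of sets).\<close>

definition minimal_realization ::
  "complex^'n^'n \<Rightarrow> complex^'m1^'n \<Rightarrow> complex^'n^'m2 \<Rightarrow> bool" where
  "minimal_realization A B C \<longleftrightarrow>
     (\<Sum>k<CARD('n). range (\<lambda>u. (matpow A k ** B) *v u)) = UNIV \<and>
     (\<Sum>k<CARD('n). range (\<lambda>u. (matpow (cadj A) k ** cadj C) *v u)) = UNIV"

text \<open>
  The disjointness condition says that the rational function is defined on all of the set where
  it is required to be contractive: in a minimal realization its poles are exactly the eigenvalues
  of A. Without it, \<^const>\<open>matrix_inv\<close> would be evaluated at singular matrices.
\<close>

definition class_G ::
  "((complex^'n^'n) \<times> (complex^'m1^'n) \<times> (complex^'n^'m2)) set" where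
  "class_G = {(A, B, C). minimal_realization A B C \<and>
     (\<real> \<union> {z. 0 < Im z}) \<inter> spectrum A = {} \<and>
     contractive_on (\<real> \<union> {z. 0 < Im z}) (realization A B C)}"

definition riccati_solution ::
  "complex^'n^'n \<Rightarrow> complex^'m1^'n \<Rightarrow> complex^'n^'m2 \<Rightarrow> complex^'n^'n \<Rightarrow> bool" where
  "riccati_solution A B C X \<longleftrightarrow>
     X ** B ** cadj B ** X + \<i> *\<^sub>C (cadj A ** X - X ** A) + cadj C ** C = 0"

definition selected_solution ::
  "complex^'n^'n \<Rightarrow> complex^'m1^'n \<Rightarrow> complex^'n^'m2 \<Rightarrow> complex^'n^'n \<Rightarrow> bool" where
  "selected_solution A B C X \<longleftrightarrow>
     pos_def X \<and> riccati_solution A B C X \<and>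
     spectrum (A + \<i> *\<^sub>C (B ** cadj B ** X)) \<subseteq> {z. Im z < 0} \<union> \<real>"

definition Lambda_fun ::
  "complex^'n^'n \<Rightarrow> complex^'m1^'n \<Rightarrow> complex^'m2^'n \<Rightarrow> real \<Rightarrow> complex^('m1 + 'm2)^'n" where
  "Lambda_fun \<alpha> \<theta>1 \<theta>2 x =
     hcat (matexp ((- \<i> * of_real x) *\<^sub>C \<alpha>) ** \<theta>1) (matexp ((\<i> * of_real x) *\<^sub>C \<alpha>) ** \<theta>2)"

definition S_fun ::
  "complex^'n^'n \<Rightarrow> complex^'n^'n \<Rightarrow> complex^'m1^'n \<Rightarrow> complex^'m2^'n \<Rightarrow> real \<Rightarrow> complex^'n^'n"
where
  "S_fun \<alpha> S0 \<theta>1 \<theta>2 x =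
     S0 + integral {0..x} (\<lambda>t. Lambda_fun \<alpha> \<theta>1 \<theta>2 t ** cadj (Lambda_fun \<alpha> \<theta>1 \<theta>2 t))"

definition pseudo_exp_potential ::
  "complex^'n^'n \<Rightarrow> complex^'n^'n \<Rightarrow> complex^'m1^'n \<Rightarrow> complex^'m2^'n \<Rightarrow> real \<Rightarrow> complex^'m2^'m1"
where
  "pseudo_exp_potential \<alpha> S0 \<theta>1 \<theta>2 x =
     (- 2 * \<i>) *\<^sub>C (cadj \<theta>1 ** matexp ((\<i> * of_real x) *\<^sub>C cadj \<alpha>)
       ** matrix_inv (S_fun \<alpha> S0 \<theta>1 \<theta>2 x) ** matexp ((\<i> * of_real x) *\<^sub>C \<alpha>) ** \<theta>2)"

text \<open>
  For triples in the class, X exists and is unique, so v is determined on the half-line; its values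
  at negative arguments are irrelevant.
\<close>

definition recovered_potential ::
  "complex^'n^'n \<Rightarrow> complex^'m1^'n \<Rightarrow> complex^'n^'m2 \<Rightarrow> (real \<Rightarrow> complex^'m2^'m1) \<Rightarrow> bool" where
  "recovered_potential A B C v \<longleftrightarrow>
     (\<exists>X. selected_solution A B C X \<and>
       (\<forall>x\<ge>0. v x = pseudo_exp_potential
          (A + \<i> *\<^sub>C (B ** cadj B ** X)) (matrix_inv X)
          B ((- \<i>) *\<^sub>C (matrix_inv X ** cadj C)) x))"

end

theory Submission
  imports Defs "HOL-Complex_Analysis.Complex_Analysis"
    "HOL-Computational_Algebra.Fundamental_Theorem_Algebra"
begin

text \<open>
  Let the data converge. Controllability keeps the solutions X bounded; by Hurwitz's theorem every
  limit point is again a Hermitian solution whose closed-loop spectrum lies in the closed lower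
  half-plane, and such a solution is unique, since the difference of two of them would give the
  matrix A a real eigenvalue. So X depends continuously on the data.

  On compact intervals the potential depends continuously on the data. For the tail, put E(x) for
  the exponential of ix alpha. The node identity makes R = E S E* and R' = E^(-1) S (E^(-1))*
  nondecreasing, and Cauchy-Schwarz for the inverse of S bounds |v|^2 by the product of the norms
  of the inverses of R and R', up to constants. Here R' stays above its initial value, while R
  grows without bound in every direction: the directions in which it stays bounded form an
  invariant subspace of alpha*, and an eigenvector in it would give A an eigenvalue outside the
  open lower half-plane. A lower bound for R at one point T survives perturbation of the data and,
  by monotonicity, holds on all of the half-line from T on.
\<close>

section \<open>Complex matrices and the real inner product\<close>

text \<open>The obstacle is the half-line. The matrix alpha may have real eigenvalues, and then no
  exponential decay can be expected: for A = -i, B = C = 1 one gets X = 1, alpha = 0 and v(x) = -2 /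
  (1 + 2x). Nor can the factors of the potential be bounded one by one, since exp(ix alpha) grows
  along eigenvalues in the open lower half-plane. So the tail estimate treats the product as a whole
  and uses order instead of rates: one inequality at one point T, propagated by monotonicity.

  The argument runs along sequences: a failure for every delta produces triples converging to the
  given one. Compactness then enters three times, for the solutions X, for the unit vectors in which
  R is tested, and for the points x at which the potentials stay apart. An explicit delta is never
  computed.\<close>

lemma smul_mult_left: "(c *\<^sub>C M) ** N = c *\<^sub>C (M ** N)"
  by (simp add: smul_def matrix_matrix_mult_def vec_eq_iff sum_distrib_left mult.assoc)

lemma smul_mult_right: "M ** (c *\<^sub>C N) = c *\<^sub>C (M ** N)"
  by (simp add: smul_def matrix_matrix_mult_def vec_eq_iff sum_distrib_left algebra_simps)

lemma smul_mult_vec: "(c *\<^sub>C M) *v w = c *s (M *v w)"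
  by (simp add: smul_def matrix_vector_mult_def vec_eq_iff sum_distrib_left mult.assoc)

lemma smul_smul [simp]: "c *\<^sub>C (d *\<^sub>C M) = (c * d) *\<^sub>C M"
  by (simp add: smul_def vec_eq_iff mult.assoc)

lemma smul_add: "c *\<^sub>C (M + N) = c *\<^sub>C M + c *\<^sub>C N"
  by (simp add: smul_def vec_eq_iff algebra_simps)

lemma smul_diff: "c *\<^sub>C (M - N) = c *\<^sub>C M - c *\<^sub>C N"
  by (simp add: smul_def vec_eq_iff algebra_simps)

lemma smul_minus_left: "(- c) *\<^sub>C M = - (c *\<^sub>C M)"
  by (simp add: smul_def vec_eq_iff)

lemma smul_one [simp]: "1 *\<^sub>C M = M"
  by (simp add: smul_def vec_eq_iff)

lemma smul_zero [simp]: "0 *\<^sub>C M = 0" "c *\<^sub>C 0 = 0"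
  by (simp_all add: smul_def vec_eq_iff)

lemma smul_of_real: "of_real r *\<^sub>C M = r *\<^sub>R M"
  by (simp add: smul_def vec_eq_iff scaleR_conv_of_real[where 'a=complex])

lemma cadj_mult: "cadj (M ** N) = cadj N ** cadj M"
  by (simp add: cadj_def matrix_matrix_mult_def vec_eq_iff mult.commute)

lemma cadj_cadj [simp]: "cadj (cadj M) = M"
  by (simp add: cadj_def vec_eq_iff)

lemma cadj_add: "cadj (M + N) = cadj M + cadj N"
  by (simp add: cadj_def vec_eq_iff)

lemma cadj_diff: "cadj (M - N) = cadj M - cadj N"
  by (simp add: cadj_def vec_eq_iff)

lemma cadj_smul: "cadj (c *\<^sub>C M) = cnj c *\<^sub>C cadj M"
  by (simp add: cadj_def smul_def vec_eq_iff)

lemma cadj_scaleR: "cadj (r *\<^sub>R M) = r *\<^sub>R cadj M"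
  by (simp add: cadj_def vec_eq_iff)

lemma cadj_mat: "cadj (mat c) = mat (cnj c)"
  by (simp add: cadj_def mat_def vec_eq_iff)

lemma cadj_0 [simp]: "cadj 0 = 0"
  by (simp add: cadj_def vec_eq_iff)

lemma inner_complex_mult: "a \<bullet> (m * b) = (cnj m * a) \<bullet> (b::complex)"
  by (simp add: inner_complex_def algebra_simps)

text \<open>The inner product of the type is the real part of the Hermitian form, and adjointness
  survives taking real parts. For Hermitian M the form w* M w is real, so the quadratic forms below
  lose nothing.\<close>

lemma inner_mult_vec: "u \<bullet> (M *v w) = (cadj M *v u) \<bullet> w" for u :: "complex^'n"
proof -
  have "u \<bullet> (M *v w) = (\<Sum>i\<in>UNIV. \<Sum>j\<in>UNIV. u$i \<bullet> (M$i$j * w$j))"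
    by (simp add: inner_vec_def matrix_vector_mult_def inner_sum_right)
  also have "\<dots> = (\<Sum>j\<in>UNIV. \<Sum>i\<in>UNIV. (cnj (M$i$j) * u$i) \<bullet> w$j)"
    by (subst sum.swap) (simp add: inner_complex_mult)
  also have "\<dots> = (cadj M *v u) \<bullet> w"
    by (simp add: inner_vec_def matrix_vector_mult_def cadj_def inner_sum_left)
  finally show ?thesis .
qed

lemma inner_cscale: "u \<bullet> (c *s w) = (cnj c *s u) \<bullet> w" for u :: "complex^'n"
  by (simp add: inner_vec_def inner_complex_mult)

lemma norm_cscale: "norm (c *s w) = norm c * norm w" for w :: "complex^'n"
  by (simp add: norm_vec_def norm_mult L2_set_right_distrib)

lemma inner_cscale_cscale: "(c *s u) \<bullet> (c *s w) = (norm c)\<^sup>2 * (u \<bullet> w)" for u :: "complex^'n"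
proof -
  have "(c * a) \<bullet> (c * b) = (norm c)\<^sup>2 * (a \<bullet> b)" for a b
    unfolding inner_complex_def cmod_power2 by (simp add: power2_eq_square algebra_simps)
  then show ?thesis
    by (simp add: inner_vec_def sum_distrib_left)
qed

lemma cscale_of_real: "of_real r *s w = r *\<^sub>R w" for w :: "complex^'n"
  by (simp add: vec_eq_iff scaleR_conv_of_real[where 'a=complex])

lemma cscale_scaleR: "c *s (r *\<^sub>R w) = r *\<^sub>R (c *s w)" for w :: "complex^'n"
  by (simp add: vec_eq_iff scaleR_conv_of_real[where 'a=complex])

lemma mat_mult_vec: "mat c *v w = c *s w" for w :: "complex^'n"
  by (simp add: vec_eq_iff matrix_vector_mult_def mat_def if_distrib cong: if_cong)
    (simp add: if_distribR if_distrib sum.delta cong: if_cong)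

lemma mult_vec_cscale: "M *v (c *s w) = c *s (M *v w)" for w :: "complex^'n"
  by (simp add: vector_scalar_commute)

lemma bounded_bilinear_matrix_mult:
  "bounded_bilinear ((**) :: complex^'b^'a \<Rightarrow> complex^'c^'b \<Rightarrow> complex^'c^'a)"
  unfolding bilinear_conv_bounded_bilinear[symmetric] bilinear_def
  by (auto intro!: linearI simp: matrix_matrix_mult_def vec_eq_iff sum.distrib algebra_simps
      scaleR_conv_of_real[where 'a=complex] sum_distrib_left)

lemma bounded_bilinear_matrix_vector_mult:
  "bounded_bilinear ((*v) :: complex^'b^'a \<Rightarrow> complex^'b \<Rightarrow> complex^'a)"
  unfolding bilinear_conv_bounded_bilinear[symmetric] bilinear_def
  by (auto intro!: linearI simp: matrix_vector_mult_def vec_eq_iff sum.distrib algebra_simps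
      scaleR_conv_of_real[where 'a=complex] sum_distrib_left)

lemma bounded_bilinear_smul:
  "bounded_bilinear ((*\<^sub>C) :: complex \<Rightarrow> complex^'b^'a \<Rightarrow> complex^'b^'a)"
  unfolding bilinear_conv_bounded_bilinear[symmetric] bilinear_def
  by (auto intro!: linearI simp: smul_def vec_eq_iff algebra_simps)

lemma bounded_linear_cadj: "bounded_linear (cadj :: complex^'b^'a \<Rightarrow> complex^'a^'b)"
  unfolding linear_conv_bounded_linear[symmetric]
  by (auto intro!: linearI simp: cadj_add cadj_scaleR)

lemmas tendsto_matrix_mult [tendsto_intros] = bounded_bilinear.tendsto[OF bounded_bilinear_matrix_mult]
lemmas tendsto_matrix_vector_mult [tendsto_intros] =
  bounded_bilinear.tendsto[OF bounded_bilinear_matrix_vector_mult]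
lemmas tendsto_smul [tendsto_intros] = bounded_bilinear.tendsto[OF bounded_bilinear_smul]
lemmas tendsto_cadj [tendsto_intros] = bounded_linear.tendsto[OF bounded_linear_cadj]
lemmas continuous_on_matrix_mult [continuous_intros] =
  bounded_bilinear.continuous_on[OF bounded_bilinear_matrix_mult]
lemmas continuous_on_matrix_vector_mult [continuous_intros] =
  bounded_bilinear.continuous_on[OF bounded_bilinear_matrix_vector_mult]
lemmas continuous_on_smul [continuous_intros] =
  bounded_bilinear.continuous_on[OF bounded_bilinear_smul]
lemmas continuous_on_cadj [continuous_intros] =
  bounded_linear.continuous_on[OF bounded_linear_cadj]

section \<open>Operator norm and convergence\<close>

lemma opnorm_bound: "\<exists>K>0. \<forall>M::complex^'b^'a. opnorm M \<le> K * norm M"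
proof -
  obtain K where K: "K > 0" "\<And>(M::complex^'b^'a) w. norm (M *v w) \<le> norm M * norm w * K"
    using bounded_bilinear.pos_bounded[OF bounded_bilinear_matrix_vector_mult[where 'a='a and 'b='b]]
    by blast
  have "opnorm M \<le> K * norm M" for M :: "complex^'b^'a"
    unfolding opnorm_def using K by (intro onorm_le) (simp add: mult_ac)
  then show ?thesis using K(1) by blast
qed

lemma norm_mult_vec_le_opnorm: "norm (M *v w) \<le> opnorm M * norm w" for M :: "complex^'b^'a"
  unfolding opnorm_def by (rule onorm) simp

lemma opnorm_nonneg: "0 \<le> opnorm M" for M :: "complex^'b^'a"
  unfolding opnorm_def by (rule onorm_pos_le) simp

lemma opnorm_tendsto_0:
  fixes M :: "'x \<Rightarrow> complex^'b^'a"
  assumes "(M \<longlongrightarrow> 0) F"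
  shows "((\<lambda>k. opnorm (M k)) \<longlongrightarrow> 0) F"
proof -
  obtain K where "K > 0" and K: "\<And>M::complex^'b^'a. opnorm M \<le> K * norm M"
    using opnorm_bound by blast
  show ?thesis
  proof (rule tendsto_sandwich[OF _ _ tendsto_const])
    show "\<forall>\<^sub>F k in F. opnorm (M k) \<le> K * norm (M k)" using K by simp
    show "((\<lambda>k. K * norm (M k)) \<longlongrightarrow> 0) F"
      using tendsto_mult_left[OF tendsto_norm_zero[OF assms], of K] by simp
  qed (simp add: opnorm_nonneg)
qed

lemma norm_entry_le_opnorm: "norm (M $ i $ j) \<le> opnorm M" for M :: "complex^'b^'a"
proof -
  have "M *v axis j 1 = column j M"
    by (simp add: vec_eq_iff matrix_vector_mult_def axis_def column_def if_distrib cong: if_cong)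
  then have "norm (M $ i $ j) \<le> norm (M *v axis j 1)"
    using Finite_Cartesian_Product.norm_nth_le[of "column j M" i] by (simp add: column_def)
  also have "\<dots> \<le> opnorm M"
    using norm_mult_vec_le_opnorm[of M "axis j 1"] by (simp add: norm_axis_1)
  finally show ?thesis .
qed

text \<open>The theorem measures closeness by \<open>opnorm\<close>, whereas limits live in the
  topology of the type. Domination of every entry by \<open>opnorm\<close> is all that the passage
  needs.\<close>

lemma tendsto_of_opnorm_diff:
  fixes M :: "'x \<Rightarrow> complex^'b^'a"
  assumes "((\<lambda>k. opnorm (N - M k)) \<longlongrightarrow> 0) F"
  shows "(M \<longlongrightarrow> N) F"
proof (intro vec_tendstoI)
  fix i j
  have "((\<lambda>k. M k $ i $ j - N $ i $ j) \<longlongrightarrow> 0) F"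
  proof (rule Lim_null_comparison[OF _ assms])
    show "\<forall>\<^sub>F k in F. norm (M k $ i $ j - N $ i $ j) \<le> opnorm (N - M k)"
      using norm_entry_le_opnorm[of "N - M _" i j] by (simp add: norm_minus_commute)
  qed
  then show "((\<lambda>k. M k $ i $ j) \<longlongrightarrow> N $ i $ j) F"
    by (simp add: LIM_zero_iff)
qed

section \<open>Spectrum, eigenvectors and positivity\<close>

lemma spectrum_iff_eigenvector:
  "\<mu> \<in> spectrum M \<longleftrightarrow> (\<exists>w. w \<noteq> 0 \<and> M *v w = \<mu> *s w)" for M :: "complex^'n^'n"
proof -
  have "\<mu> \<in> spectrum M \<longleftrightarrow> \<not> (\<forall>w. (mat \<mu> - M) *v w = 0 \<longrightarrow> w = 0)"
    by (simp add: spectrum_def invertible_left_inverse matrix_left_invertible_ker)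
  also have "\<dots> \<longleftrightarrow> (\<exists>w. w \<noteq> 0 \<and> M *v w = \<mu> *s w)"
    by (auto simp: matrix_vector_mult_diff_rdistrib mat_mult_vec eq_commute[of "M *v _"])
  finally show ?thesis .
qed

lemma spectrum_cadj: "\<mu> \<in> spectrum (cadj M) \<Longrightarrow> cnj \<mu> \<in> spectrum M" for M :: "complex^'n^'n"
proof -
  assume "\<mu> \<in> spectrum (cadj M)"
  moreover have "invertible (mat \<mu> - cadj M)" if inv: "invertible (mat (cnj \<mu>) - M)"
  proof -
    obtain N where N: "N ** (mat (cnj \<mu>) - M) = mat 1" "(mat (cnj \<mu>) - M) ** N = mat 1"
      using inv unfolding invertible_def by blast
    have "(mat \<mu> - cadj M) ** cadj N = mat 1"  "cadj N ** (mat \<mu> - cadj M) = mat 1"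
      using arg_cong[OF N(1), of cadj] arg_cong[OF N(2), of cadj]
      by (simp_all add: cadj_mult cadj_diff cadj_mat)
    then show ?thesis unfolding invertible_def by blast
  qed
  ultimately show ?thesis by (auto simp: spectrum_def)
qed

text \<open>The vector p(M) u, that is, the polynomial evaluated at the matrix and applied to
  u.\<close>

definition pvec :: "complex^'n^'n \<Rightarrow> complex^'n \<Rightarrow> complex poly \<Rightarrow> complex^'n" where
  "pvec M u p = (\<Sum>k\<le>degree p. coeff p k *s (matpow M k *v u))"

lemma pvec_eq_sum:
  assumes "degree p \<le> d"
  shows "pvec M u p = (\<Sum>k\<le>d. coeff p k *s (matpow M k *v u))"
  unfolding pvec_def
  by (rule sum.mono_neutral_left) (use assms in \<open>auto simp: coeff_eq_0\<close>)

lemma pvec_pCons: "pvec M u (pCons a p) = a *s u + M *v pvec M u p"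
proof -
  have "pvec M u (pCons a p) = (\<Sum>k\<le>Suc (degree p). coeff (pCons a p) k *s (matpow M k *v u))"
    by (rule pvec_eq_sum) (simp add: degree_pCons_le)
  also have "\<dots> = a *s u + (\<Sum>k\<le>degree p. coeff p k *s (M *v (matpow M k *v u)))"
    by (subst sum.atMost_Suc_shift) (simp add: matrix_vector_mul_assoc)
  also have "\<dots> = a *s u + M *v pvec M u p"
    by (simp add: pvec_def linear_sum[OF matrix_vector_mul_linear, unfolded o_def] mult_vec_cscale)
  finally show ?thesis .
qed

lemma pvec_smult: "pvec M u (smult c p) = c *s pvec M u p"
  by (simp add: pvec_eq_sum[of _ "degree p"] degree_smult_le vec_eq_iff sum_distrib_left mult.assoc)

lemma pvec_add: "pvec M u (p + q) = pvec M u p + pvec M u q"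
  by (simp add: pvec_eq_sum[of _ "max (degree p) (degree q)"] degree_add_le_max
      vector_sadd_rdistrib sum.distrib)

lemma exists_annihilating_poly:
  fixes M :: "complex^'n^'n"
  shows "\<exists>p. p \<noteq> 0 \<and> pvec M u p = 0"
proof -
  \<comment> \<open>The real dimension, twice the matrix size. The dependence found below has real
    coefficients, which serve as complex ones.\<close>
  let ?d = "DIM(complex^'n)"
  let ?f = "\<lambda>k. matpow M k *v u"
  consider "inj_on ?f {..?d}" | "\<not> inj_on ?f {..?d}" by blast
  then show ?thesis
  proof cases
    case 1
    then have "card (?f ` {..?d}) = Suc ?d" by (simp add: card_image)
    then have "dependent (?f ` {..?d})"
      using dependent_biggerset[of "?f ` {..?d}"] by simp
    then obtain c v where c: "v \<in> ?f ` {..?d}" "c v \<noteq> 0"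
        "(\<Sum>w\<in>?f ` {..?d}. c w *\<^sub>R w) = 0"
      using dependent_finite[of "?f ` {..?d}"] by auto
    then have s0: "(\<Sum>k\<le>?d. c (?f k) *\<^sub>R ?f k) = 0"
      using sum.reindex[OF 1, of "\<lambda>w. c w *\<^sub>R w"] by simp
    define p where "p = (\<Sum>k\<le>?d. monom (complex_of_real (c (?f k))) k)"
    have cf: "coeff p k = (if k \<le> ?d then of_real (c (?f k)) else 0)" for k
      by (simp add: p_def coeff_sum sum.delta)
    have "degree p \<le> ?d" by (rule degree_le) (simp add: cf)
    then have "pvec M u p = (\<Sum>k\<le>?d. coeff p k *s ?f k)" by (rule pvec_eq_sum)
    also have "\<dots> = (\<Sum>k\<le>?d. c (?f k) *\<^sub>R ?f k)"
      by (rule sum.cong) (simp_all only: cf atMost_iff if_True cscale_of_real)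
    finally have "pvec M u p = 0" using s0 by simp
    moreover from c(1) obtain k where "k \<le> ?d" "v = ?f k" by auto
    then have "p \<noteq> 0" using cf[of k] c(2) by auto
    ultimately show ?thesis by blast
  next
    \<comment> \<open>Two powers agree on u, so the image is too small for the dimension count; here
      the difference of two monomials annihilates u directly.\<close>
    case 2
    then obtain j k where jk: "j \<noteq> k" "?f j = ?f k" unfolding inj_on_def by blast
    define p where "p = monom (1::complex) j - monom 1 k"
    have "coeff p j = 1" using jk by (simp add: p_def)
    then have "p \<noteq> 0" by auto
    have mon: "pvec M u (monom c i) = c *s ?f i" for c i
      by (subst pvec_eq_sum[of _ i]) (simp_all add: degree_monom_le if_distrib if_distribR sum.delta cong: if_cong)
    have "pvec M u p = pvec M u (monom 1 j) + pvec M u (monom (-1) k)"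
      by (simp add: p_def flip: pvec_add minus_monom)
    then have "pvec M u p = 0" using jk by (simp add: mon vector_sneg_minus1[symmetric])
    with \<open>p \<noteq> 0\<close> show ?thesis by blast
  qed
qed

text \<open>Split a root mu off a polynomial p of least degree with p(M) u = 0. The quotient q gives
  a vector q(M) u that is nonzero by minimality, lies in V and is killed by M - mu. The closure
  properties of V are spelled out because \<open>subspace\<close> is a notion over the reals
  here.\<close>

lemma eigenvector_in_invariant_subspace:
  fixes M :: "complex^'n^'n"
  assumes add: "\<And>u w. u \<in> V \<Longrightarrow> w \<in> V \<Longrightarrow> u + w \<in> V"
    and scale: "\<And>c u. u \<in> V \<Longrightarrow> c *s u \<in> V"
    and inv: "\<And>u. u \<in> V \<Longrightarrow> M *v u \<in> V"
    and u: "u \<in> V" "u \<noteq> 0"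
  obtains \<mu> w where "w \<in> V" "w \<noteq> 0" "M *v w = \<mu> *s w"
proof -
  have "pvec M u p \<in> V" for p
  proof (induction p)
    case 0
    show ?case using scale[OF u(1), of 0] by (simp add: pvec_def)
  next
    case (pCons a p)
    then show ?case by (simp add: pvec_pCons add scale inv u)
  qed
  define P where "P = (\<lambda>p. p \<noteq> 0 \<and> pvec M u p = 0)"
  obtain p where p: "P p" "\<And>q. P q \<Longrightarrow> degree p \<le> degree q"
    using exists_annihilating_poly[of M u] ex_has_least_nat[of P _ degree] unfolding P_def by metis
  have "degree p \<noteq> 0"
  proof
    assume "degree p = 0"
    then obtain a where "p = [:a:]" by (metis degree_eq_zeroE)
    with p(1) u(2) show False by (auto simp: P_def pvec_pCons pvec_def)
  qed
  then obtain \<mu> where "poly p \<mu> = 0"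
    using Fundamental_Theorem_Algebra.fundamental_theorem_of_algebra[of p] by (auto simp: constant_degree)
  then obtain q where q: "p = [:- \<mu>, 1:] * q" by (auto simp: poly_eq_0_iff_dvd dvd_def)
  have "q \<noteq> 0" using q p(1) by (auto simp: P_def)
  then have "degree q < degree p" by (simp add: q degree_mult_eq del: mult_pCons_left)
  then have "pvec M u q \<noteq> 0" using p(2)[of q] \<open>q \<noteq> 0\<close> by (auto simp: P_def)
  moreover have "p = pCons 0 q + smult (- \<mu>) q" by (simp add: q)
  then have "pvec M u p = M *v pvec M u q - \<mu> *s pvec M u q"
    by (simp add: pvec_add pvec_smult[of _ _ "- \<mu>"] pvec_pCons vector_smult_lneg del: smult_minus_left)
  then have "M *v pvec M u q = \<mu> *s pvec M u q" using p(1) by (simp add: P_def)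
  ultimately show thesis using that \<open>pvec M u q \<in> V\<close> by blast
qed

section \<open>Hermitian matrices, quadratic forms and coercivity\<close>

lemmas matrix_mult_diff_left = bounded_bilinear.diff_left[OF bounded_bilinear_matrix_mult]
lemmas matrix_mult_diff_right = bounded_bilinear.diff_right[OF bounded_bilinear_matrix_mult]
lemmas matrix_mult_add_left = bounded_bilinear.add_left[OF bounded_bilinear_matrix_mult]
lemmas matrix_mult_add_right = bounded_bilinear.add_right[OF bounded_bilinear_matrix_mult]
lemmas matrix_mult_minus_left = bounded_bilinear.minus_left[OF bounded_bilinear_matrix_mult]
lemmas matrix_mult_minus_right = bounded_bilinear.minus_right[OF bounded_bilinear_matrix_mult]
lemmas matrix_mult_scaleR_left = bounded_bilinear.scaleR_left[OF bounded_bilinear_matrix_mult]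
lemmas matrix_mult_scaleR_right = bounded_bilinear.scaleR_right[OF bounded_bilinear_matrix_mult]
lemmas mult_vec_scaleR = bounded_bilinear.scaleR_right[OF bounded_bilinear_matrix_vector_mult]

lemma hermitian_inner: "hermitian M \<Longrightarrow> u \<bullet> (M *v w) = (M *v u) \<bullet> w" for M :: "complex^'n^'n"
  by (simp add: inner_mult_vec hermitian_def)

lemma hermitian_diff: "hermitian M \<Longrightarrow> hermitian N \<Longrightarrow> hermitian (M - N)"
  by (simp add: hermitian_def cadj_diff)

lemma hermitian_limit:
  fixes M :: "nat \<Rightarrow> complex^'n^'n"
  assumes "M \<longlonglongrightarrow> N" "\<And>k. hermitian (M k)"
  shows "hermitian N"
proof -
  have "(\<lambda>k. cadj (M k)) \<longlonglongrightarrow> cadj N" by (intro tendsto_intros assms)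
  then show ?thesis using assms LIMSEQ_unique by (auto simp: hermitian_def)
qed

lemma inner_mult_cadj: "w \<bullet> ((M ** cadj M) *v w) = (norm (cadj M *v w))\<^sup>2" for w :: "complex^'n"
  by (simp add: matrix_vector_mul_assoc[symmetric] inner_mult_vec[of w] power2_norm_eq_inner)

text \<open>The left side is the imaginary part of w* D w, a real number for Hermitian D.\<close>

lemma hermitian_inner_imaginary:
  assumes "hermitian D"
  shows "(\<i> *s w) \<bullet> (D *v w) = 0"
proof -
  have "(\<i> *s w) \<bullet> (D *v w) = (\<i> *s (D *v w)) \<bullet> w"
    by (simp add: hermitian_inner[OF assms] mult_vec_cscale)
  also have "\<dots> = w \<bullet> (\<i> *s (D *v w))" by (rule inner_commute)
  also have "\<dots> = - ((\<i> *s w) \<bullet> (D *v w))"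
    by (subst inner_cscale) (simp add: vector_smult_lneg)
  finally show ?thesis by simp
qed

lemma psd_cauchy_schwarz:
  fixes M :: "complex^'n^'n"
  assumes h: "hermitian M" and psd: "\<And>w. 0 \<le> w \<bullet> (M *v w)"
  shows "(u \<bullet> (M *v w))\<^sup>2 \<le> (u \<bullet> (M *v u)) * (w \<bullet> (M *v w))"
proof -
  let ?a = "u \<bullet> (M *v u)" and ?b = "u \<bullet> (M *v w)" and ?c = "w \<bullet> (M *v w)"
  have b: "w \<bullet> (M *v u) = ?b" using hermitian_inner[OF h] by (metis inner_commute)
  have q: "0 \<le> ?a + 2 * t * ?b + t\<^sup>2 * ?c" for t
  proof -
    have "0 \<le> (u + t *\<^sub>R w) \<bullet> (M *v (u + t *\<^sub>R w))" by (rule psd)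
    also have "\<dots> = ?a + 2 * t * ?b + t\<^sup>2 * ?c"
      by (simp add: matrix_vector_right_distrib mult_vec_scaleR inner_add_left
          inner_add_right b power2_eq_square algebra_simps)
    finally show ?thesis .
  qed
  show ?thesis
  proof (cases "?c = 0")
    case True
    have "?b = 0"
    proof (rule ccontr)
      assume "?b \<noteq> 0"
      \<comment> \<open>At this t the affine function \<open>?a + 2 * t * ?b\<close> takes the value
        -1.\<close>
      then show False using q[of "- (?a + 1) / (2 * ?b)"] True by (simp add: field_simps)
    qed
    then show ?thesis using True by simp
  next
    case False
    then have "?c > 0" using psd[of w] by simp
    have "0 \<le> ?a - ?b\<^sup>2 / ?c"
      using q[of "- ?b / ?c"] False by (simp add: field_simps power2_eq_square)
    then show ?thesis using \<open>?c > 0\<close> by (simp add: field_simps)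
  qed
qed

text \<open>Cauchy-Schwarz with \<open>M *v u\<close> itself as the first vector bounds the fourth
  power of its norm by 0.\<close>

lemma psd_null:
  fixes M :: "complex^'n^'n"
  assumes "hermitian M" "\<And>w. 0 \<le> w \<bullet> (M *v w)" "u \<bullet> (M *v u) = 0"
  shows "M *v u = 0"
  using psd_cauchy_schwarz[OF assms(1,2), of "M *v u" u] assms(3) by simp

lemma quadratic_form_scale:
  fixes M :: "complex^'n^'n"
  assumes "\<And>w. norm w = 1 \<Longrightarrow> c \<le> w \<bullet> (M *v w)"
  shows "c * (norm w)\<^sup>2 \<le> w \<bullet> (M *v w)"
proof (cases "w = 0")
  case False
  let ?e = "(1 / norm w) *\<^sub>R w"
  have w: "w = norm w *\<^sub>R ?e" using False by simp
  have "w \<bullet> (M *v w) = (norm w)\<^sup>2 * (?e \<bullet> (M *v ?e))"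
    by (subst w, subst (2) w) (simp add: mult_vec_scaleR power2_eq_square False)
  moreover have "c \<le> ?e \<bullet> (M *v ?e)" using False by (intro assms) simp
  then have "(norm w)\<^sup>2 * c \<le> (norm w)\<^sup>2 * (?e \<bullet> (M *v ?e))" by (intro mult_left_mono) simp_all
  ultimately show ?thesis by (simp only: mult.commute)
qed simp

lemma continuous_on_quadratic_form:
  "continuous_on S (\<lambda>w. w \<bullet> (M *v w))" for M :: "complex^'n^'n"
  by (intro continuous_intros)

lemma quadratic_form_minimum:
  fixes M :: "complex^'n^'n"
  obtains u where "norm u = 1" "\<And>w. (u \<bullet> (M *v u)) * (norm w)\<^sup>2 \<le> w \<bullet> (M *v w)"
proof -
  have ne: "sphere (0::complex^'n) 1 \<noteq> {}" by simp
  obtain u where u: "u \<in> sphere 0 1" "\<And>w. w \<in> sphere 0 1 \<Longrightarrow> u \<bullet> (M *v u) \<le> w \<bullet> (M *v w)"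
    using continuous_attains_inf[OF compact_sphere ne continuous_on_quadratic_form[of _ M]] by auto
  show thesis
    by (rule that[of u]) (use u in \<open>auto intro!: quadratic_form_scale\<close>)
qed

text \<open>For Hermitian M: the least eigenvalue is at least c. The explicit constant lets
  positivity pass through limits and along monotone families with uniform bounds.\<close>

definition coercive :: "real \<Rightarrow> complex^'n^'n \<Rightarrow> bool" where
  "coercive c M \<longleftrightarrow> (\<forall>w. c * (norm w)\<^sup>2 \<le> w \<bullet> (M *v w))"

text \<open>If the form of X has minimum m on the unit sphere, attained at u, then X - m has a
  nonnegative form that vanishes at u. Hence X u = m u, and the spectral definition of positivity
  gives m > 0.\<close>

lemma pos_def_coercive:
  fixes X :: "complex^'n^'n"
  assumes "pos_def X"
  obtains c where "c > 0" "coercive c X"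
proof -
  have h: "hermitian X" using assms by (simp add: pos_def_def)
  obtain u where u: "norm u = 1" "\<And>w. (u \<bullet> (X *v u)) * (norm w)\<^sup>2 \<le> w \<bullet> (X *v w)"
    using quadratic_form_minimum by blast
  define m where "m = u \<bullet> (X *v u)"
  let ?M = "X - mat (of_real m)"
  have Mw: "?M *v w = X *v w - m *\<^sub>R w" for w
    by (simp add: matrix_vector_mult_diff_rdistrib mat_mult_vec cscale_of_real)
  have "?M *v u = 0"
  proof (rule psd_null)
    show "hermitian ?M" using h by (simp add: hermitian_def cadj_diff cadj_mat)
    show "0 \<le> w \<bullet> (?M *v w)" for w
      using u(2)[of w] unfolding Mw inner_diff_right m_def[symmetric]
      by (simp add: power2_norm_eq_inner)
    show "u \<bullet> (?M *v u) = 0"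
      using u(1) unfolding Mw inner_diff_right m_def[symmetric] by (simp add: norm_eq_1)
  qed
  then have "X *v u = of_real m *s u" by (simp add: Mw cscale_of_real)
  moreover have "u \<noteq> 0" using u(1) by auto
  ultimately have "of_real m \<in> spectrum X" using spectrum_iff_eigenvector by blast
  then have "m > 0" using assms by (auto simp: pos_def_def)
  then show thesis using that[of m] u(2) by (auto simp: m_def coercive_def)
qed

section \<open>Inverses of coercive matrices and their limits\<close>

lemma matrix_inv_mult:
  fixes M :: "complex^'n^'n"
  assumes "invertible M"
  shows "M ** matrix_inv M = mat 1" "matrix_inv M ** M = mat 1"
  using someI_ex[OF assms[unfolded invertible_def]] by (simp_all add: matrix_inv_def)

lemma matrix_inv_unique:
  fixes M :: "complex^'n^'n"
  assumes "M ** N = mat 1"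
  shows "matrix_inv M = N"
proof -
  have "N ** M = mat 1" using assms matrix_left_right_inverse by blast
  with assms have "invertible M" unfolding invertible_def by blast
  have "matrix_inv M = matrix_inv M ** (M ** N)" by (simp add: assms)
  also have "\<dots> = N" by (simp add: matrix_mul_assoc matrix_inv_mult[OF \<open>invertible M\<close>])
  finally show ?thesis .
qed

lemma hermitian_matrix_inv:
  fixes M :: "complex^'n^'n"
  assumes "invertible M" "hermitian M"
  shows "hermitian (matrix_inv M)"
proof -
  have "cadj M ** cadj (matrix_inv M) = mat 1"
    using arg_cong[OF matrix_inv_mult(2)[OF assms(1)], of cadj] by (simp add: cadj_mult cadj_mat)
  then have "M ** cadj (matrix_inv M) = mat 1" using assms(2) by (simp add: hermitian_def)
  from matrix_inv_unique[OF this] show ?thesis by (simp add: hermitian_def)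
qed

lemma coercive_norm:
  assumes "coercive c M"
  shows "c * norm w \<le> norm (M *v w)"
proof (cases "w = 0")
  case False
  have "c * (norm w)\<^sup>2 \<le> norm w * norm (M *v w)"
    using assms norm_cauchy_schwarz[of w "M *v w"] unfolding coercive_def by (meson order_trans)
  then show ?thesis using False by (simp add: power2_eq_square)
qed simp

lemma coercive_invertible:
  assumes "coercive c M" "c > 0"
  shows "invertible M"
proof -
  have "w = 0" if "M *v w = 0" for w
    using coercive_norm[OF assms(1), of w] that assms(2) by (simp add: mult_le_0_iff)
  then show ?thesis by (simp add: invertible_left_inverse matrix_left_invertible_ker)
qed

lemma coercive_norm_inv:
  assumes "coercive c M" "c > 0"
  shows "norm (matrix_inv M *v w) \<le> norm w / c"
  using coercive_norm[OF assms(1), of "matrix_inv M *v w"] assms(2)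
  by (simp add: matrix_vector_mul_assoc matrix_inv_mult[OF coercive_invertible[OF assms]] field_simps)

lemma coercive_inv_nonneg:
  assumes "coercive c M" "c > 0"
  shows "0 \<le> w \<bullet> (matrix_inv M *v w)"
proof -
  let ?y = "matrix_inv M *v w"
  have "w = M *v ?y"
    by (simp add: matrix_vector_mul_assoc matrix_inv_mult[OF coercive_invertible[OF assms]])
  then have "w \<bullet> ?y = ?y \<bullet> (M *v ?y)" by (metis inner_commute)
  moreover have "0 \<le> c * (norm ?y)\<^sup>2" using assms(2) by simp
  ultimately show ?thesis using assms(1) unfolding coercive_def by (metis order_trans)
qed

lemma coercive_inv_le:
  assumes "coercive c M" "c > 0"
  shows "w \<bullet> (matrix_inv M *v w) \<le> (norm w)\<^sup>2 / c"
proof -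
  have "w \<bullet> (matrix_inv M *v w) \<le> norm w * norm (matrix_inv M *v w)" by (rule norm_cauchy_schwarz)
  also have "\<dots> \<le> norm w * (norm w / c)"
    by (intro mult_left_mono coercive_norm_inv assms) simp
  finally show ?thesis by (simp add: power2_eq_square)
qed

text \<open>The gap c - c' absorbs the operator norm of the perturbation.\<close>

lemma eventually_coercive:
  fixes M :: "nat \<Rightarrow> complex^'n^'n"
  assumes lim: "M \<longlonglongrightarrow> N" and co: "coercive c N" and c': "c' < c"
  shows "\<forall>\<^sub>F k in sequentially. coercive c' (M k)"
proof -
  have "(\<lambda>k. N - M k) \<longlonglongrightarrow> N - N" by (intro tendsto_intros lim)
  then have "(\<lambda>k. opnorm (N - M k)) \<longlonglongrightarrow> 0" by (intro opnorm_tendsto_0) simp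
  then have "\<forall>\<^sub>F k in sequentially. opnorm (N - M k) < c - c'"
    by (rule order_tendstoD) (use c' in simp)
  then show ?thesis
  proof eventually_elim
    case (elim k)
    show ?case
      unfolding coercive_def
    proof
      fix w
      have "w \<bullet> ((N - M k) *v w) \<le> norm w * norm ((N - M k) *v w)" by (rule norm_cauchy_schwarz)
      also have "\<dots> \<le> norm w * (opnorm (N - M k) * norm w)"
        by (intro mult_left_mono norm_mult_vec_le_opnorm) simp
      also have "\<dots> \<le> norm w * ((c - c') * norm w)"
        using elim by (intro mult_left_mono mult_right_mono) auto
      finally have "w \<bullet> (N *v w) - w \<bullet> (M k *v w) \<le> (c - c') * (norm w)\<^sup>2"
        by (simp add: matrix_vector_mult_diff_rdistrib inner_diff_right power2_eq_square mult_ac)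
      moreover have "c * (norm w)\<^sup>2 \<le> w \<bullet> (N *v w)" using co by (simp add: coercive_def)
      ultimately show "c' * (norm w)\<^sup>2 \<le> w \<bullet> (M k *v w)" by (simp add: algebra_simps)
    qed
  qed
qed

lemma tendsto_matrix_inv:
  fixes M :: "nat \<Rightarrow> complex^'n^'n"
  assumes lim: "M \<longlonglongrightarrow> N" and co: "coercive c N" and c: "c > 0"
  shows "(\<lambda>k. matrix_inv (M k)) \<longlonglongrightarrow> matrix_inv N"
proof (rule tendsto_of_opnorm_diff)
  let ?D = "\<lambda>k. (M k - N) ** matrix_inv N"
  have c2: "c / 2 > 0" using c by simp
  have iN: "invertible N" using coercive_invertible[OF co c] .
  have "(\<lambda>k. ?D k) \<longlonglongrightarrow> (N - N) ** matrix_inv N" by (intro tendsto_intros lim)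
  then have "(\<lambda>k. opnorm (?D k)) \<longlonglongrightarrow> 0" by (intro opnorm_tendsto_0) simp
  then have D0: "(\<lambda>k. opnorm (?D k) / (c / 2)) \<longlonglongrightarrow> 0"
    using tendsto_divide_zero by blast
  have "opnorm (matrix_inv N - matrix_inv (M k)) \<le> opnorm (?D k) / (c / 2)"
    if cok: "coercive (c / 2) (M k)" for k
    unfolding opnorm_def[of "matrix_inv N - matrix_inv (M k)"]
  proof (rule onorm_le)
    fix w
    \<comment> \<open>Resolvent identity. The factor \<open>matrix_inv (M k)\<close> is bounded by
      2/c uniformly in k, so the difference is as small as \<open>?D k\<close>.\<close>
    have eq: "matrix_inv N - matrix_inv (M k) = matrix_inv (M k) ** ?D k"
      using matrix_inv_mult[OF iN] matrix_inv_mult[OF coercive_invertible[OF cok c2]]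
      by (simp add: matrix_mul_assoc matrix_mult_diff_left matrix_mult_diff_right)
    have "norm ((matrix_inv N - matrix_inv (M k)) *v w) = norm (matrix_inv (M k) *v (?D k *v w))"
      by (simp add: eq matrix_vector_mul_assoc)
    also have "\<dots> \<le> norm (?D k *v w) / (c / 2)" by (rule coercive_norm_inv[OF cok c2])
    also have "\<dots> \<le> opnorm (?D k) * norm w / (c / 2)"
      using c by (intro divide_right_mono norm_mult_vec_le_opnorm) simp
    finally show "norm ((matrix_inv N - matrix_inv (M k)) *v w) \<le> opnorm (?D k) / (c / 2) * norm w"
      by (simp add: mult_ac)
  qed
  moreover have "\<forall>\<^sub>F k in sequentially. coercive (c / 2) (M k)"
    using c by (intro eventually_coercive[OF lim co]) simp
  ultimately show "(\<lambda>k. opnorm (matrix_inv N - matrix_inv (M k))) \<longlonglongrightarrow> 0"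
    by (intro tendsto_sandwich[OF _ _ tendsto_const D0])
      (auto simp: opnorm_nonneg elim: eventually_mono)
qed

text \<open>Cauchy-Schwarz for the form of M, applied to w and to y = M^(-1) w, bounds the fourth
  power of the norm of w by the product of the forms of M and its inverse at w. It turns an upper
  bound for X into a lower bound for its inverse, the initial value of S.\<close>

lemma coercive_matrix_inv:
  fixes M :: "complex^'n^'n"
  assumes h: "hermitian M" and co: "coercive c M" "c > 0" and K: "opnorm M \<le> K" "K > 0"
  shows "coercive (1 / K) (matrix_inv M)"
  unfolding coercive_def
proof
  fix w
  let ?y = "matrix_inv M *v w"
  have psd: "0 \<le> u \<bullet> (M *v u)" for u
  proof -
    have "0 \<le> c * (norm u)\<^sup>2" using co(2) by simp
    then show ?thesis using co(1) by (auto simp: coercive_def intro: order_trans)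
  qed
  have My: "M *v ?y = w"
    by (simp add: matrix_vector_mul_assoc matrix_inv_mult[OF coercive_invertible[OF co]])
  then have yMy: "?y \<bullet> (M *v ?y) = w \<bullet> ?y" by (simp add: inner_commute)
  have "((norm w)\<^sup>2)\<^sup>2 = (w \<bullet> (M *v ?y))\<^sup>2" by (simp add: My power2_norm_eq_inner)
  also have "\<dots> \<le> (w \<bullet> (M *v w)) * (?y \<bullet> (M *v ?y))" by (rule psd_cauchy_schwarz[OF h psd])
  also have "\<dots> \<le> (K * (norm w)\<^sup>2) * (w \<bullet> ?y)"
    unfolding yMy
  proof (rule mult_right_mono)
    have "w \<bullet> (M *v w) \<le> norm w * (opnorm M * norm w)"
      by (rule order_trans[OF norm_cauchy_schwarz mult_left_mono[OF norm_mult_vec_le_opnorm]]) simp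
    also have "\<dots> \<le> norm w * (K * norm w)" using K(1) by (intro mult_left_mono mult_right_mono) auto
    finally show "w \<bullet> (M *v w) \<le> K * (norm w)\<^sup>2" by (simp add: power2_eq_square mult_ac)
    show "0 \<le> w \<bullet> ?y" using psd[of ?y] by (simp add: yMy)
  qed
  finally have "(norm w)\<^sup>2 * (norm w)\<^sup>2 \<le> (norm w)\<^sup>2 * (K * (w \<bullet> ?y))"
    by (simp add: power2_eq_square mult_ac)
  then have "(norm w)\<^sup>2 \<le> K * (w \<bullet> ?y)" if "w \<noteq> 0"
    by (rule mult_left_le_imp_le) (use that in simp)
  then have "w = 0 \<or> (norm w)\<^sup>2 \<le> K * (w \<bullet> ?y)" by blast
  then show "1 / K * (norm w)\<^sup>2 \<le> w \<bullet> ?y" using K(2) by (auto simp: field_simps)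
qed

section \<open>Characteristic polynomials and limits of spectra\<close>

lemma det_char_holomorphic: "(\<lambda>z. det (mat z - M)) holomorphic_on S" for M :: "complex^'n^'n"
proof -
  have "(\<lambda>z. (mat z - M) $ i $ j) holomorphic_on S" for i j
    by (cases "i = j") (auto simp: mat_def intro!: holomorphic_intros)
  then show ?thesis unfolding det_def by (intro holomorphic_intros)
qed

lemma det_char_continuous:
  "continuous_on S (\<lambda>(N, z). det (mat z - N))" for S :: "((complex^'n^'n) \<times> complex) set"
proof -
  have "continuous_on S (\<lambda>x. (mat (snd x) - fst x) $ i $ j)" for i j
    by (cases "i = j") (auto simp: mat_def intro!: continuous_intros)
  then show ?thesis unfolding det_def case_prod_beta
    by (intro continuous_on_sum continuous_on_mult continuous_on_const continuous_on_prod)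
qed

lemma spectrum_large: "opnorm M < norm z \<Longrightarrow> z \<notin> spectrum M" for M :: "complex^'n^'n"
proof
  assume z: "opnorm M < norm z" "z \<in> spectrum M"
  then obtain w where "w \<noteq> 0" "M *v w = z *s w" using spectrum_iff_eigenvector by blast
  then show False using norm_mult_vec_le_opnorm[of M w] z(1) by (simp add: norm_cscale)
qed

text \<open>Hurwitz's theorem, applied to the characteristic polynomials.\<close>

lemma spectrum_limit_lower_half:
  fixes M :: "nat \<Rightarrow> complex^'n^'n"
  assumes lim: "M \<longlonglongrightarrow> N" and sp: "\<And>k. spectrum (M k) \<subseteq> {z. Im z \<le> 0}"
  shows "spectrum N \<subseteq> {z. Im z \<le> 0}"
proof (rule subsetI, rule ccontr)
  fix z0 assume z0: "z0 \<in> spectrum N" "z0 \<notin> {z. Im z \<le> 0}"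
  let ?S = "{z. 0 < Im z}"
  let ?h = "\<lambda>(N::complex^'n^'n, z). det (mat z - N)"
  have sp_det: "z \<in> spectrum L \<longleftrightarrow> det (mat z - L) = 0" for z and L :: "complex^'n^'n"
    by (simp add: spectrum_def invertible_det_nz)
  have "det (mat z0 - N) \<noteq> 0"
  proof (rule Hurwitz_no_zeros[of ?S "\<lambda>k z. det (mat z - M k)" "\<lambda>z. det (mat z - N)"])
    show "open ?S" by (rule open_halfspace_Im_gt)
    show "connected ?S" by (intro convex_connected convex_halfspace_Im_gt)
    show "\<And>k. (\<lambda>z. det (mat z - M k)) holomorphic_on ?S" by (rule det_char_holomorphic)
    show "(\<lambda>z. det (mat z - N)) holomorphic_on ?S" by (rule det_char_holomorphic)
    show "det (mat z - M k) \<noteq> 0" if "z \<in> ?S" for k z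
      using sp[of k] that sp_det[of z "M k"] by auto
    show "z0 \<in> ?S" using z0 by simp
    show "\<not> (\<lambda>z. det (mat z - N)) constant_on ?S"
    proof
      assume "(\<lambda>z. det (mat z - N)) constant_on ?S"
      \<comment> \<open>A point beyond the disc of radius \<open>opnorm N\<close>: the
        characteristic polynomial does not vanish there, while constancy would give it the value 0
        that it has at \<open>z0\<close>.\<close>
      moreover define z1 where "z1 = \<i> * of_real (opnorm N + 1)"
      have "z1 \<in> ?S" "opnorm N < norm z1"
        using opnorm_nonneg[of N] by (simp_all add: z1_def norm_mult)
      ultimately have "det (mat z1 - N) = det (mat z0 - N)"
        using \<open>z0 \<in> ?S\<close> unfolding constant_on_def by metis
      then show False
        using z0(1) spectrum_large[OF \<open>opnorm N < norm z1\<close>] by (simp add: sp_det)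
    qed
    fix K :: "complex set" assume "compact K" "K \<subseteq> ?S"
    \<comment> \<open>A convergent sequence together with its limit is compact, so the determinant
      is uniformly continuous on \<open>?C\<close>; this yields uniform convergence on K.\<close>
    let ?C = "insert N (range M) \<times> K"
    have "uniformly_continuous_on ?C ?h"
      by (intro compact_uniformly_continuous det_char_continuous compact_Times
          compact_sequence_with_limit[OF lim] \<open>compact K\<close>)
    show "uniform_limit K (\<lambda>k z. det (mat z - M k)) (\<lambda>z. det (mat z - N)) sequentially"
    proof (rule uniform_limitI)
      fix e :: real assume "e > 0"
      then obtain d where d: "d > 0" "\<And>x y. x \<in> ?C \<Longrightarrow> y \<in> ?C \<Longrightarrow> dist y x < d \<Longrightarrow> dist (?h y) (?h x) < e"
        using \<open>uniformly_continuous_on ?C ?h\<close> unfolding uniformly_continuous_on_def by metis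
      have "\<forall>\<^sub>F k in sequentially. dist (M k) N < d" using lim d(1) by (rule tendstoD)
      then show "\<forall>\<^sub>F k in sequentially. \<forall>z\<in>K. dist (det (mat z - M k)) (det (mat z - N)) < e"
      proof eventually_elim
        case (elim k)
        show ?case
        proof
          fix z assume "z \<in> K"
          then show "dist (det (mat z - M k)) (det (mat z - N)) < e"
            using d(2)[of "(N, z)" "(M k, z)"] elim by (simp add: dist_Pair_Pair)
        qed
      qed
    qed
  qed
  then show False using z0(1) by (simp add: sp_det)
qed

section \<open>The selected solution of the Riccati equation\<close>

lemma cscale_Re_Im: "c *s w = Re c *\<^sub>R w + Im c *\<^sub>R (\<i> *s w)" for w :: "complex^'n"
  by (simp add: vec_eq_iff complex_eq_iff)

text \<open>By \<open>eq\<close> the range of D is invariant under \<open>cadj F\<close>, so it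
  contains an eigenvector u = D w. The pairing of w with D F w equals \<open>cnj \<mu>\<close> times
  w* D w by adjointness, and \<mu> times w* D w plus i times the squared norm of
  \<open>cadj B *v u\<close> by \<open>eq\<close>. Comparing imaginary parts gives the last
  identity.\<close>

lemma intertwining_eigenvector:
  fixes F D :: "complex^'n^'n" and B :: "complex^'m^'n"
  assumes D: "hermitian D" "D \<noteq> 0"
    and eq: "cadj F ** D = D ** (F - \<i> *\<^sub>C (B ** cadj B ** D))"
  obtains \<mu> w where "D *v w \<noteq> 0" "cadj F *v (D *v w) = \<mu> *s (D *v w)"
    "- 2 * Im \<mu> * (w \<bullet> (D *v w)) = (norm (cadj B *v (D *v w)))\<^sup>2"
proof -
  let ?G = "F - \<i> *\<^sub>C (B ** cadj B ** D)"
  obtain x where x: "D *v x \<noteq> 0" using D(2) by (auto simp: matrix_eq)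
  obtain \<mu> u where u: "u \<in> range ((*v) D)" "u \<noteq> 0" "cadj F *v u = \<mu> *s u"
  proof (rule eigenvector_in_invariant_subspace[of "range ((*v) D)" "cadj F" "D *v x"])
    show "a + b \<in> range ((*v) D)" if "a \<in> range ((*v) D)" "b \<in> range ((*v) D)" for a b
      using that by (auto simp: image_iff) (metis matrix_vector_right_distrib)
    show "c *s a \<in> range ((*v) D)" if "a \<in> range ((*v) D)" for c a
      using that by (auto simp: image_iff) (metis mult_vec_cscale)
    show "cadj F *v a \<in> range ((*v) D)" if "a \<in> range ((*v) D)" for a
      using that by (auto simp: image_iff matrix_vector_mul_assoc eq)
        (metis matrix_vector_mul_assoc)
  qed (use x in auto)
  then obtain w where w: "u = D *v w" by blast
  let ?b = "cadj B *v u"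
  have im0: "(\<i> *s w) \<bullet> u = 0" "(\<i> *s u) \<bullet> w = 0"
    using hermitian_inner_imaginary[OF D(1), of w] inner_cscale[of w \<i> u]
    by (simp_all add: w vector_smult_lneg inner_commute)
  have "D *v (?G *v w) = \<mu> *s u"
    using u(3) eq by (simp add: w matrix_vector_mul_assoc)
  moreover have "D *v (?G *v w) = D *v (F *v w) - \<i> *s (D *v (B *v ?b))"
    by (simp add: matrix_vector_mult_diff_rdistrib matrix_vector_mult_diff_distrib
        smul_mult_vec mult_vec_cscale w matrix_vector_mul_assoc matrix_mul_assoc)
  ultimately have DF: "D *v (F *v w) = \<mu> *s u + \<i> *s (D *v (B *v ?b))"
    by (simp add: algebra_simps)
  \<comment> \<open>Multiplying the first slot by i makes the real inner product read off the
    imaginary part of the pairing.\<close>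
  have "(\<i> *s w) \<bullet> (D *v (F *v w)) = (cadj F *v (\<i> *s u)) \<bullet> w"
    by (simp only: hermitian_inner[OF D(1)] mult_vec_cscale[of D] inner_mult_vec[of "\<i> *s (D *v w)"] w)
  also have "\<dots> = (\<i> *s (\<mu> *s u)) \<bullet> w" by (simp add: mult_vec_cscale u(3))
  also have "\<dots> = - Im \<mu> * (w \<bullet> u)"
    by (subst cscale_Re_Im[of \<mu>])
      (simp add: vector_add_ldistrib cscale_scaleR vector_smult_assoc inner_add_left
        inner_diff_left im0 vector_smult_lneg inner_commute[of u w])
  finally have 1: "(\<i> *s w) \<bullet> (D *v (F *v w)) = - Im \<mu> * (w \<bullet> u)" .
  have "(\<i> *s w) \<bullet> (\<i> *s (D *v (B *v ?b))) = w \<bullet> (D *v (B *v ?b))"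
    by (simp add: inner_cscale_cscale)
  also have "\<dots> = (norm ?b)\<^sup>2"
    by (simp add: hermitian_inner[OF D(1)] inner_mult_vec[of "D *v w"] w power2_norm_eq_inner)
  finally have "(\<i> *s w) \<bullet> (\<i> *s (D *v (B *v ?b))) = (norm ?b)\<^sup>2" .
  moreover have "(\<i> *s w) \<bullet> (\<mu> *s u) = Im \<mu> * (w \<bullet> u)"
    by (subst cscale_Re_Im[of \<mu>]) (simp add: inner_add_right im0 inner_cscale_cscale)
  ultimately have "(\<i> *s w) \<bullet> (D *v (F *v w)) = Im \<mu> * (w \<bullet> u) + (norm ?b)\<^sup>2"
    by (simp add: DF inner_add_right)
  with 1 have "- 2 * Im \<mu> * (w \<bullet> u) = (norm ?b)\<^sup>2" by simp
  with that[of w \<mu>] u show thesis by (simp add: w)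
qed

lemma riccati_solution_cadj:
  assumes "riccati_solution A B C X"
  shows "cadj A ** X = X ** A + \<i> *\<^sub>C (X ** B ** cadj B ** X) + \<i> *\<^sub>C (cadj C ** C)"
proof -
  have "\<i> *\<^sub>C (X ** B ** cadj B ** X + \<i> *\<^sub>C (cadj A ** X - X ** A) + cadj C ** C) = 0"
    using assms by (simp add: riccati_solution_def)
  then show ?thesis
    by (simp add: smul_add smul_minus_left[of 1, simplified] algebra_simps)
qed

text \<open>Subtracting the two equations cancels the constant term, and the quadratic terms combine
  with A into the closed-loop matrices: D intertwines the adjoint of the one for X with the one for
  Y.\<close>

lemma riccati_difference:
  assumes "riccati_solution A B C X" "riccati_solution A B C Y" "hermitian X" "hermitian Y"
  defines "D \<equiv> X - Y" and "F \<equiv> A + \<i> *\<^sub>C (B ** cadj B ** X)"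
  shows "cadj F ** D = D ** (F - \<i> *\<^sub>C (B ** cadj B ** D))"
    and "F - \<i> *\<^sub>C (B ** cadj B ** D) = A + \<i> *\<^sub>C (B ** cadj B ** Y)"
proof -
  show G: "F - \<i> *\<^sub>C (B ** cadj B ** D) = A + \<i> *\<^sub>C (B ** cadj B ** Y)"
    by (simp add: F_def D_def matrix_mult_diff_right smul_diff)
  have "cadj X = X" using assms(3) by (simp add: hermitian_def)
  then have "cadj F = cadj A - \<i> *\<^sub>C (X ** B ** cadj B)"
    by (simp add: F_def cadj_add cadj_smul cadj_mult matrix_mul_assoc smul_minus_left)
  then show "cadj F ** D = D ** (F - \<i> *\<^sub>C (B ** cadj B ** D))"
    unfolding G
    by (simp add: D_def matrix_mult_diff_right matrix_mult_diff_left matrix_mult_add_right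
        smul_mult_left smul_mult_right smul_diff matrix_mul_assoc
        riccati_solution_cadj[OF assms(1)] riccati_solution_cadj[OF assms(2)])
qed

lemma riccati_unique:
  fixes A :: "complex^'n^'n"
  assumes ric: "riccati_solution A B C X" "riccati_solution A B C Y"
    and herm: "hermitian X" "hermitian Y"
    and spX: "spectrum (A + \<i> *\<^sub>C (B ** cadj B ** X)) \<subseteq> {z. Im z \<le> 0}"
    and spY: "spectrum (A + \<i> *\<^sub>C (B ** cadj B ** Y)) \<subseteq> {z. Im z \<le> 0}"
    and real: "\<real> \<inter> spectrum A = {}"
  shows "X = Y"
proof (rule ccontr)
  assume "X \<noteq> Y"
  define D where "D = X - Y"
  define F where "F = A + \<i> *\<^sub>C (B ** cadj B ** X)"
  define G where "G = A + \<i> *\<^sub>C (B ** cadj B ** Y)"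
  note diff = riccati_difference[OF ric herm, folded D_def F_def G_def]
  have hD: "hermitian D" using herm by (simp add: D_def hermitian_diff)
  have "D \<noteq> 0" using \<open>X \<noteq> Y\<close> by (simp add: D_def)
  then obtain \<mu> w where w: "D *v w \<noteq> 0" "cadj F *v (D *v w) = \<mu> *s (D *v w)"
    "- 2 * Im \<mu> * (w \<bullet> (D *v w)) = (norm (cadj B *v (D *v w)))\<^sup>2"
    using intertwining_eigenvector[OF hD _ diff(1)] by metis
  define u where "u = D *v w"
  note w = w[folded u_def]
  have "\<mu> \<in> spectrum (cadj F)" using w spectrum_iff_eigenvector by blast
  then have "Im (cnj \<mu>) \<le> 0" using spectrum_cadj spX F_def by blast
  then have ge: "0 \<le> Im \<mu>" by simp
  have DG: "D *v (G *v x) = cadj F *v (D *v x)" for x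
    using diff by (simp add: matrix_vector_mul_assoc)
  \<comment> \<open>If \<mu> - G were injective, it would map the kernel of D, which is G-invariant,
    onto itself. It sends w into this kernel, so w would lie there, against D w \<noteq> 0.\<close>
  have "\<mu> \<in> spectrum G"
  proof (rule ccontr)
    assume ns: "\<mu> \<notin> spectrum G"
    let ?T = "\<lambda>x. \<mu> *s x - G *v x"
    let ?V = "{x. D *v x = 0}"
    have T: "?T = (\<lambda>x. (mat \<mu> - G) *v x)"
      by (simp add: fun_eq_iff matrix_vector_mult_diff_rdistrib mat_mult_vec)
    have lin: "linear ?T" unfolding T by (rule matrix_vector_mul_linear)
    have inj: "inj ?T"
      unfolding linear_injective_0[OF lin] using ns spectrum_iff_eigenvector[of \<mu> G] by auto
    have V: "subspace ?V"
      by (auto simp: subspace_def matrix_vector_right_distrib mult_vec_scaleR)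
    have sub: "?T ` ?V \<subseteq> ?V"
      by (auto simp: matrix_vector_mult_diff_distrib mult_vec_cscale DG)
    have "dim (?T ` ?V) = dim ?V"
      using dim_image_eq[OF lin inj_on_subset[OF inj]] by blast
    then have "?T ` ?V = ?V"
      using subspace_dim_equal[OF linear_subspace_image[OF lin V] V sub] by simp
    moreover have "?T w \<in> ?V"
      using w(2) by (simp add: matrix_vector_mult_diff_distrib mult_vec_cscale DG u_def)
    ultimately obtain x where "x \<in> ?V" "?T w = ?T x" by blast
    then have "w \<in> ?V" using inj by (auto dest: injD)
    then show False using w(1) by (simp add: u_def)
  qed
  then have "Im \<mu> \<le> 0" using spY G_def by blast
  with ge have im: "Im \<mu> = 0" by simp
  \<comment> \<open>For real \<mu> the identity leaves only the B term. Its vanishing makes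
    \<open>cadj F\<close> and \<open>cadj A\<close> agree on u.\<close>
  with w(3) have B0: "cadj B *v u = 0" by simp
  have "cadj F *v u = cadj A *v u"
  proof -
    have "cadj F = cadj A - \<i> *\<^sub>C (cadj X ** B ** cadj B)"
      by (simp add: F_def cadj_add cadj_smul cadj_mult matrix_mul_assoc smul_minus_left)
    then show ?thesis
      by (simp add: matrix_vector_mult_diff_rdistrib smul_mult_vec B0
          flip: matrix_vector_mul_assoc)
  qed
  with w have "\<mu> \<in> spectrum (cadj A)" by (auto simp: spectrum_iff_eigenvector)
  then have "cnj \<mu> \<in> spectrum A" by (rule spectrum_cadj)
  moreover have "cnj \<mu> \<in> \<real>" using im by (simp add: complex_is_Real_iff)
  ultimately show False using real by blast
qed

text \<open>Reduces the controllability condition, a sum of sets, to its summands: if every summand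
  lies in V, then V is everything.\<close>

lemma set_sum_subset:
  fixes S :: "'i \<Rightarrow> ('a::comm_monoid_add) set"
  assumes "\<And>i. i \<in> I \<Longrightarrow> S i \<subseteq> V" "0 \<in> V" "\<And>x y. x \<in> V \<Longrightarrow> y \<in> V \<Longrightarrow> x + y \<in> V"
  shows "(\<Sum>i\<in>I. S i) \<subseteq> V"
  using assms(1)
proof (induction I rule: infinite_finite_induct)
  case (insert i I)
  then have "S i \<subseteq> V" "(\<Sum>i\<in>I. S i) \<subseteq> V" by auto
  then show ?case using insert.hyps by (auto simp: set_plus_def intro!: assms(3))
qed (use assms(2) in auto)

text \<open>
  Rescaling an unbounded sequence of solutions to norm 1 leaves in the limit a Hermitian matrix
  whose kernel is A-invariant and contains the range of B, contradicting controllability.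
\<close>

lemma riccati_bounded:
  fixes A :: "nat \<Rightarrow> complex^'n^'n" and B :: "nat \<Rightarrow> complex^'m1^'n" and C :: "nat \<Rightarrow> complex^'n^'m2"
  assumes A: "A \<longlonglongrightarrow> A0" and B: "B \<longlonglongrightarrow> B0" and C: "C \<longlonglongrightarrow> C0"
    and ctrl: "(\<Sum>k<CARD('n). range (\<lambda>u. (matpow A0 k ** B0) *v u)) = UNIV"
    and ric: "\<And>k. riccati_solution (A k) (B k) (C k) (X k)" and herm: "\<And>k. hermitian (X k)"
  shows "\<exists>K. \<forall>k. norm (X k) \<le> K"
proof (rule ccontr)
  assume unb: "\<not> ?thesis"
  have "\<exists>n\<ge>N. norm (X n) > real N" for N
  proof -
    have nn: "0 \<le> (\<Sum>i\<le>N. norm (X i))" by (simp add: sum_nonneg)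
    \<comment> \<open>Adding the norms of the first matrices to the threshold forces the index
      beyond N, so the data still converge along the chosen indices.\<close>
    obtain n where n: "norm (X n) > real N + (\<Sum>i\<le>N. norm (X i))"
      using unb not_le by metis
    have "n \<ge> N"
    proof (rule ccontr)
      assume "\<not> n \<ge> N"
      then have "norm (X n) \<le> (\<Sum>i\<le>N. norm (X i))" by (intro member_le_sum) auto
      then show False using n by simp
    qed
    then show ?thesis using n nn by (intro exI[of _ n]) simp
  qed
  then obtain r where r: "\<And>N. r N \<ge> N" "\<And>N. norm (X (r N)) > real N" by metis
  define Y where "Y = (\<lambda>k. (1 / norm (X (r k))) *\<^sub>R X (r k))"
  have pos: "norm (X (r k)) > 0" for k using r(2)[of k] by (meson of_nat_0_le_iff le_less_trans)
  have "Y k \<in> sphere 0 1" for k using pos[of k] by (simp add: Y_def)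
  then obtain Z s where Z: "Z \<in> sphere 0 1" and s: "strict_mono s" and Ylim: "(Y \<circ> s) \<longlonglongrightarrow> Z"
    using compact_sphere[of "0::complex^'n^'n" 1] unfolding compact_def by metis
  define q where "q = (\<lambda>k. r (s k))"
  define t where "t = (\<lambda>k. 1 / norm (X (q k)))"
  have qk: "q k \<ge> k" for k using r(1)[of "s k"] seq_suble[OF s, of k] by (simp add: q_def)
  have q: "filterlim q at_top sequentially"
    by (rule filterlim_at_top_mono[OF filterlim_ident]) (simp add: qk)
  have Yq: "(\<lambda>k. t k *\<^sub>R X (q k)) \<longlonglongrightarrow> Z"
    using Ylim by (simp add: Y_def q_def t_def o_def)
  note Aq = filterlim_compose[OF A q] and Bq = filterlim_compose[OF B q] and Cq = filterlim_compose[OF C q]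
  have t0: "t \<longlonglongrightarrow> 0"
  proof -
    have "real k \<le> norm (X (q k))" for k
      using r(2)[of "s k"] seq_suble[OF s, of k] by (simp add: q_def)
    then have "filterlim (\<lambda>k. norm (X (q k))) at_top sequentially"
      using filterlim_at_top_mono[OF filterlim_real_sequentially] by (auto simp: eventually_sequentially)
    then show ?thesis unfolding t_def by (intro tendsto_divide_0[OF tendsto_const] filterlim_at_top_imp_at_infinity)
  qed
  \<comment> \<open>The quadratic term carries the small factor t only once. By the Riccati equation
    it is then affine in the bounded matrices t X and converges; a second factor t yields Z B B* Z =
    0 in the limit.\<close>
  define P where "P = (\<lambda>k. t k *\<^sub>R (X (q k) ** B (q k) ** cadj (B (q k)) ** X (q k)))"
  define P0 where "P0 = (- \<i>) *\<^sub>C (cadj A0 ** Z - Z ** A0)"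
  have P_eq: "P k = (- \<i>) *\<^sub>C (cadj (A (q k)) ** (t k *\<^sub>R X (q k)) - (t k *\<^sub>R X (q k)) ** A (q k))
      - t k *\<^sub>R (cadj (C (q k)) ** C (q k))" for k
  proof -
    have "X (q k) ** B (q k) ** cadj (B (q k)) ** X (q k)
      = (- \<i>) *\<^sub>C (cadj (A (q k)) ** X (q k) - X (q k) ** A (q k)) - cadj (C (q k)) ** C (q k)"
      using ric[of "q k"] by (simp add: riccati_solution_def smul_minus_left eq_neg_iff_add_eq_0 algebra_simps)
    then show ?thesis
      by (simp add: P_def matrix_mult_scaleR_left matrix_mult_scaleR_right scaleR_diff_right
        bounded_bilinear.scaleR_right[OF bounded_bilinear_smul] smul_diff)
  qed
  have Plim: "P \<longlonglongrightarrow> P0"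
  proof -
    have "P \<longlonglongrightarrow> (- \<i>) *\<^sub>C (cadj A0 ** Z - Z ** A0) - 0 *\<^sub>R (cadj C0 ** C0)"
      unfolding P_eq by (intro tendsto_intros Aq Yq Cq t0)
    then show ?thesis by (simp add: P0_def)
  qed
  have P_psd: "0 \<le> w \<bullet> (P k *v w)" for k w
  proof -
    have "w \<bullet> (P k *v w) = t k * (norm (cadj (B (q k)) *v (X (q k) *v w)))\<^sup>2"
      using herm[of "q k"]
      by (simp add: P_def bounded_bilinear.scaleR_left[OF bounded_bilinear_matrix_vector_mult]
        hermitian_inner inner_mult_vec[of "X (q k) *v w"] power2_norm_eq_inner
        flip: matrix_vector_mul_assoc)
    then show ?thesis by (simp add: t_def)
  qed
  have P_herm: "hermitian (P k)" for k
    using herm[of "q k"]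
    by (simp only: hermitian_def P_def cadj_scaleR cadj_mult cadj_cadj matrix_mul_assoc)
  have P0_herm: "hermitian P0" using hermitian_limit[OF Plim P_herm] .
  have P0_psd: "0 \<le> w \<bullet> (P0 *v w)" for w
  proof (rule LIMSEQ_le_const)
    show "(\<lambda>k. w \<bullet> (P k *v w)) \<longlonglongrightarrow> w \<bullet> (P0 *v w)" by (intro tendsto_intros Plim)
  qed (use P_psd in auto)
  have Z_herm: "hermitian Z"
    using Yq by (rule hermitian_limit) (use herm in \<open>simp add: hermitian_def cadj_scaleR\<close>)
  have "(\<lambda>k. t k *\<^sub>R P k) \<longlonglongrightarrow> 0 *\<^sub>R P0" by (intro tendsto_intros t0 Plim)
  moreover have "(\<lambda>k. t k *\<^sub>R P k) \<longlonglongrightarrow> Z ** B0 ** cadj B0 ** Z"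
  proof -
    have "t k *\<^sub>R P k = (t k *\<^sub>R X (q k)) ** B (q k) ** cadj (B (q k)) ** (t k *\<^sub>R X (q k))" for k
      by (simp add: P_def matrix_mult_scaleR_left matrix_mult_scaleR_right)
    then show ?thesis by (simp only:) (intro tendsto_intros Yq Bq)
  qed
  ultimately have ZBBZ: "Z ** B0 ** cadj B0 ** Z = 0" using LIMSEQ_unique by fastforce
  have "cadj B0 *v (Z *v w) = 0" for w
  proof -
    have "(norm (cadj B0 *v (Z *v w)))\<^sup>2 = w \<bullet> ((Z ** B0 ** cadj B0 ** Z) *v w)"
      by (simp add: hermitian_inner[OF Z_herm] inner_mult_vec[of "Z *v w"] power2_norm_eq_inner
        flip: matrix_vector_mul_assoc)
    then show ?thesis by (simp add: ZBBZ)
  qed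
  then have "cadj B0 ** Z = 0" by (simp add: matrix_eq matrix_vector_mul_assoc)
  then have "cadj (cadj B0 ** Z) = 0" by simp
  then have ZB: "Z ** B0 = 0" using Z_herm by (simp only: cadj_mult hermitian_def cadj_cadj)
  \<comment> \<open>On the kernel of Z the form of \<open>P0\<close> vanishes. As a limit of
    nonnegative matrices \<open>P0\<close> then kills w itself, and there \<open>P0\<close> acts as
    i Z A.\<close>
  have inv: "Z *v (A0 *v w) = 0" if "Z *v w = 0" for w
  proof -
    have Pw: "P0 *v w = \<i> *s (Z *v (A0 *v w))"
      using that by (simp add: P0_def smul_mult_vec matrix_vector_mult_diff_rdistrib vector_smult_lneg
          flip: matrix_vector_mul_assoc)
    have "w \<bullet> (P0 *v w) = (Z *v (- \<i> *s w)) \<bullet> (A0 *v w)"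
      by (simp only: Pw inner_cscale hermitian_inner[OF Z_herm]) simp
    also have "\<dots> = 0" using that by (simp only: mult_vec_cscale) simp
    finally have "P0 *v w = 0" using psd_null[OF P0_herm P0_psd] by blast
    then show ?thesis by (simp add: Pw)
  qed
  let ?V = "{w. Z *v w = 0}"
  have "Z *v (matpow A0 k *v (B0 *v u)) = 0" for k u
  proof (induction k)
    case 0
    then show ?case using ZB by (simp add: matrix_vector_mul_assoc)
  next
    case (Suc k)
    then show ?case using inv by (simp flip: matrix_vector_mul_assoc)
  qed
  then have "(\<Sum>k<CARD('n). range (\<lambda>u. (matpow A0 k ** B0) *v u)) \<subseteq> ?V"
    by (intro set_sum_subset) (auto simp: matrix_vector_right_distrib simp flip: matrix_vector_mul_assoc)
  then have "Z = 0" unfolding ctrl by (auto simp: matrix_eq)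
  then show False using Z by simp
qed

text \<open>Boundedness gives a limit point. The equation and hermiticity pass to it by continuity,
  the spectral condition by Hurwitz, so \<open>riccati_unique\<close> identifies it. One subsequence
  suffices for the final contradiction.\<close>

lemma selected_solution_subsequence:
  fixes A :: "nat \<Rightarrow> complex^'n^'n" and B :: "nat \<Rightarrow> complex^'m1^'n" and C :: "nat \<Rightarrow> complex^'n^'m2"
  assumes A: "A \<longlonglongrightarrow> A0" and B: "B \<longlonglongrightarrow> B0" and C: "C \<longlonglongrightarrow> C0"
    and G: "(A0, B0, C0) \<in> class_G" and sel0: "selected_solution A0 B0 C0 X0"
    and sel: "\<And>k. selected_solution (A k) (B k) (C k) (X k)"
  obtains r where "strict_mono r" "(X \<circ> r) \<longlonglongrightarrow> X0"
proof -
  have lower: "{z. Im z < 0} \<union> \<real> = {z. Im z \<le> 0}" by (auto simp: complex_is_Real_iff)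
  note [simp] = selected_solution_def lower pos_def_def
  have "\<exists>K. \<forall>k. norm (X k) \<le> K"
    using G sel by (intro riccati_bounded[OF A B C]) (auto simp: class_G_def minimal_realization_def)
  then obtain K where "\<And>k. X k \<in> cball 0 K" by auto
  then obtain Y r where r: "strict_mono r" and Y: "(X \<circ> r) \<longlonglongrightarrow> Y"
    using compact_cball[of "0::complex^'n^'n" K] unfolding compact_def by metis
  note lims = LIMSEQ_subseq_LIMSEQ[OF A r, unfolded o_def] LIMSEQ_subseq_LIMSEQ[OF B r, unfolded o_def]
    LIMSEQ_subseq_LIMSEQ[OF C r, unfolded o_def] Y[unfolded o_def]
  have "riccati_solution A0 B0 C0 Y"
  proof -
    let ?R = "\<lambda>A B C X. X ** B ** cadj B ** X + \<i> *\<^sub>C (cadj A ** X - X ** A) + cadj C ** C"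
    have "(\<lambda>k. ?R (A (r k)) (B (r k)) (C (r k)) (X (r k))) \<longlonglongrightarrow> ?R A0 B0 C0 Y"
      by (intro tendsto_intros lims)
    moreover have "?R (A (r k)) (B (r k)) (C (r k)) (X (r k)) = 0" for k
      using sel[of "r k"] by (simp add: riccati_solution_def)
    ultimately have "(\<lambda>k. 0) \<longlonglongrightarrow> ?R A0 B0 C0 Y" by (simp only:)
    then show ?thesis
      unfolding riccati_solution_def by (rule LIMSEQ_unique[OF _ tendsto_const])
  qed
  moreover have "hermitian Y" by (rule hermitian_limit[OF Y]) (use sel in simp)
  moreover have "spectrum (A0 + \<i> *\<^sub>C (B0 ** cadj B0 ** Y)) \<subseteq> {z. Im z \<le> 0}"
  proof (rule spectrum_limit_lower_half)
    show "(\<lambda>k. A (r k) + \<i> *\<^sub>C (B (r k) ** cadj (B (r k)) ** X (r k))) \<longlonglongrightarrow>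
        A0 + \<i> *\<^sub>C (B0 ** cadj B0 ** Y)"
      by (intro tendsto_intros lims)
  qed (use sel in simp)
  moreover have "\<real> \<inter> spectrum A0 = {}" using G by (auto simp: class_G_def)
  ultimately have "Y = X0"
    using sel0 by (intro riccati_unique[of A0 B0 C0 Y X0]) auto
  with r Y that show thesis by blast
qed

section \<open>The matrix exponential\<close>

lemma matpow_commute: "M ** matpow M k = matpow M k ** M"
  by (induction k) (simp_all, metis matrix_mul_assoc)

lemma matpow_scaleR: "matpow (x *\<^sub>R M) k = x ^ k *\<^sub>R matpow M k"
  by (induction k) (simp_all add: matrix_mult_scaleR_left matrix_mult_scaleR_right)

lemma cadj_matpow: "cadj (matpow M k) = matpow (cadj M) k"
  by (induction k) (simp_all add: cadj_mat cadj_mult matpow_commute)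

lemma norm_matpow_le:
  fixes M :: "complex^'n^'n"
  assumes K: "K \<ge> 0" "\<And>(A::complex^'n^'n) (B::complex^'n^'n). norm (A ** B) \<le> norm A * norm B * K" and M: "norm M \<le> r"
  shows "norm (matpow M k) \<le> norm (mat 1 :: complex^'n^'n) * (K * r) ^ k"
proof (induction k)
  case (Suc k)
  have "0 \<le> r" using M norm_ge_zero order_trans by blast
  have "norm (matpow M (Suc k)) \<le> norm M * norm (matpow M k) * K" using K(2) by simp
  also have "\<dots> \<le> r * (norm (mat 1 :: complex^'n^'n) * (K * r) ^ k) * K"
    using M Suc K(1) \<open>0 \<le> r\<close> by (intro mult_right_mono mult_mono) auto
  finally show ?case by (simp add: mult_ac)
qed simp

text \<open>One majorant for a whole ball serves both the convergence of the series and the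
  Weierstrass test behind continuity in M.\<close>

lemma matexp_majorant:
  "\<exists>m. (\<forall>(M::complex^'n^'n) k. norm M \<le> r \<longrightarrow> norm ((1 / fact k) *\<^sub>R matpow M k) \<le> m k) \<and> summable m"
proof -
  obtain K where K: "K > 0" "\<And>(A::complex^'n^'n) (B::complex^'n^'n). norm (A ** B) \<le> norm A * norm B * K"
    using bounded_bilinear.pos_bounded[OF bounded_bilinear_matrix_mult[where 'a='n and 'b='n and 'c='n]]
    by blast
  let ?c = "norm (mat 1 :: complex^'n^'n)"
  show ?thesis
  proof (intro exI conjI allI impI)
    fix M :: "complex^'n^'n" and k :: nat assume "norm M \<le> r"
    then have "norm (matpow M k) \<le> ?c * (K * r) ^ k" using K by (intro norm_matpow_le) auto
    then show "norm ((1 / fact k) *\<^sub>R matpow M k) \<le> ?c * ((K * r) ^ k /\<^sub>R fact k)"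
      by (simp add: divide_simps)
  next
    show "summable (\<lambda>k. ?c * ((K * r) ^ k /\<^sub>R fact k))"
      by (intro summable_mult summable_exp_generic)
  qed
qed

lemma matexp_sums: "(\<lambda>k. (1 / fact k) *\<^sub>R matpow M k) sums matexp M" for M :: "complex^'n^'n"
proof -
  obtain m where m: "\<And>(N::complex^'n^'n) k. norm N \<le> norm M \<Longrightarrow> norm ((1 / fact k) *\<^sub>R matpow N k) \<le> m k"
    "summable m" using matexp_majorant[where 'n='n, of "norm M"] by (elim exE conjE) (rule that, blast)
  have "summable (\<lambda>k. (1 / fact k) *\<^sub>R matpow M k)"
    by (rule summable_comparison_test'[OF m(2), of 0], rule m(1), rule order_refl)
  then show ?thesis unfolding matexp_def by (rule summable_sums)
qed

lemma continuous_on_matexp: "continuous_on UNIV (matexp :: complex^'n^'n \<Rightarrow> _)"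
proof -
  have "continuous_on (ball 0 r) (matexp :: complex^'n^'n \<Rightarrow> _)" for r
  proof -
    obtain m where m: "\<And>(M::complex^'n^'n) k. norm M \<le> r \<Longrightarrow> norm ((1 / fact k) *\<^sub>R matpow M k) \<le> m k"
      "summable m" using matexp_majorant[where 'n='n, of r] by (elim exE conjE) (rule that, blast)
    have "continuous_on S (\<lambda>M. matpow M k)" for S :: "(complex^'n^'n) set" and k
      by (induction k) (auto intro!: continuous_intros)
    moreover have "uniform_limit (ball 0 r) (\<lambda>k (M::complex^'n^'n). \<Sum>i<k. (1 / fact i) *\<^sub>R matpow M i)
        (\<lambda>M. \<Sum>i. (1 / fact i) *\<^sub>R matpow M i) sequentially"
      by (rule Weierstrass_m_test[OF m(1) m(2)]) simp
    ultimately show ?thesis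
      unfolding matexp_def
      by (intro uniform_limit_theorem[OF always_eventually, rotated]) (auto intro!: continuous_intros)
  qed
  then have "isCont matexp M" for M :: "complex^'n^'n"
    using continuous_on_eq_continuous_at[OF open_ball, of "0::complex^'n^'n" "norm M + 1"]
    by (metis norm_ge_zero ball_eq_empty centre_in_ball dist_0_norm less_add_one mem_ball)
  then show ?thesis by (simp add: continuous_at_imp_continuous_on)
qed

lemmas continuous_on_matexp' [continuous_intros] =
  continuous_on_compose2[OF continuous_on_matexp _ subset_UNIV]

lemma tendsto_matexp [tendsto_intros]:
  fixes f :: "'x \<Rightarrow> complex^'n^'n"
  assumes "(f \<longlongrightarrow> M) F"
  shows "((\<lambda>x. matexp (f x)) \<longlongrightarrow> matexp M) F"
  using continuous_on_tendsto_compose[OF continuous_on_matexp assms] by simp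

lemma cadj_matexp: "cadj (matexp M) = matexp (cadj M)" for M :: "complex^'n^'n"
proof (rule sums_unique2)
  show "(\<lambda>k. (1 / fact k) *\<^sub>R matpow (cadj M) k) sums cadj (matexp M)"
    using bounded_linear.sums[OF bounded_linear_cadj matexp_sums[of M]]
    by (simp add: cadj_scaleR cadj_matpow)
qed (rule matexp_sums)

lemma matexp_0 [simp]: "matexp 0 = (mat 1 :: complex^'n^'n)"
proof -
  have "matpow (0::complex^'n^'n) k = (if k = 0 then mat 1 else 0)" for k
    by (cases k) (simp_all add: bounded_bilinear.zero_left[OF bounded_bilinear_matrix_mult])
  then have "(\<lambda>k. (1 / fact k) *\<^sub>R matpow (0::complex^'n^'n) k) = (\<lambda>k. if k = 0 then mat 1 else 0)"
    by auto
  then have "(\<lambda>k. if k = 0 then mat 1 else 0) sums matexp (0::complex^'n^'n)"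
    using matexp_sums[of "0::complex^'n^'n"] by simp
  then show ?thesis using sums_single[of 0 "\<lambda>_. mat 1 :: complex^'n^'n"] by (rule sums_unique2)
qed

lemma matexp_commute: "M ** matexp M = matexp M ** M" for M :: "complex^'n^'n"
proof (rule sums_unique2)
  show "(\<lambda>k. M ** ((1 / fact k) *\<^sub>R matpow M k)) sums (M ** matexp M)"
    by (rule bounded_linear.sums[OF bounded_bilinear.bounded_linear_right[OF bounded_bilinear_matrix_mult]
          matexp_sums])
  show "(\<lambda>k. M ** ((1 / fact k) *\<^sub>R matpow M k)) sums (matexp M ** M)"
    using bounded_linear.sums[OF bounded_bilinear.bounded_linear_left[OF bounded_bilinear_matrix_mult]
        matexp_sums, of M M]
    by (simp add: matrix_mult_scaleR_left matrix_mult_scaleR_right matpow_commute)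
qed

lemma matexp_eigenvector:
  assumes "M *v w = \<mu> *s w"
  shows "matexp M *v w = exp \<mu> *s w"
proof (rule sums_unique2)
  have pow: "matpow M k *v w = \<mu> ^ k *s w" for k
    by (induction k) (simp_all add: assms mult_vec_cscale vector_smult_assoc mult.commute
        flip: matrix_vector_mul_assoc)
  have lin: "bounded_linear (\<lambda>c. c *s w)"
    unfolding linear_conv_bounded_linear[symmetric]
    by (auto intro!: linearI simp: vector_sadd_rdistrib vec_eq_iff)
  show "(\<lambda>k. (\<mu> ^ k /\<^sub>R fact k) *s w) sums (exp \<mu> *s w)"
    by (rule bounded_linear.sums[OF lin exp_converges])
  show "(\<lambda>k. (\<mu> ^ k /\<^sub>R fact k) *s w) sums (matexp M *v w)"
    using bounded_linear.sums[OF bounded_bilinear.bounded_linear_left[OF bounded_bilinear_matrix_vector_mult]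
        matexp_sums[of M], of w]
    by (simp add: bounded_bilinear.scaleR_left[OF bounded_bilinear_matrix_vector_mult] pow
        inverse_eq_divide linear_scale[OF bounded_linear.linear[OF lin]])
qed

lemma has_vector_derivative_entries:
  fixes f :: "real \<Rightarrow> complex^'b^'a"
  assumes "\<And>i j. ((\<lambda>x. f x $ i $ j) has_vector_derivative f' $ i $ j) (at x within S)"
  shows "(f has_vector_derivative f') (at x within S)"
  unfolding has_vector_derivative_def has_derivative_componentwise_within[of f]
proof
  fix e :: "complex^'b^'a" assume "e \<in> Basis"
  then obtain i j b where e: "e = axis i (axis j b)" by (auto simp: Basis_vec_def)
  have "((\<lambda>x. f x $ i $ j \<bullet> b) has_derivative (\<lambda>h. (h *\<^sub>R f' $ i $ j) \<bullet> b)) (at x within S)"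
    using assms[of i j] unfolding has_vector_derivative_def by (rule has_derivative_inner_left)
  then show "((\<lambda>x. f x \<bullet> e) has_derivative (\<lambda>h. (h *\<^sub>R f') \<bullet> e)) (at x within S)"
    by (simp add: e inner_axis)
qed

text \<open>Every entry is an everywhere convergent scalar power series in x, so termwise
  differentiation of such series applies entry by entry.\<close>

lemma matexp_scaleR_has_vector_derivative:
  fixes G :: "complex^'n^'n"
  shows "((\<lambda>x. matexp (x *\<^sub>R G)) has_vector_derivative G ** matexp (x *\<^sub>R G)) (at x within S)"
proof (rule has_vector_derivative_entries)
  fix i j
  let ?c = "\<lambda>k. matpow G k $ i $ j / fact k"
  let ?d = "\<lambda>k. (G ** matpow G k) $ i $ j / fact k"
  have entry: "bounded_linear (\<lambda>M::complex^'n^'n. M $ i $ j)"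
    using bounded_linear_compose[OF bounded_linear_vec_nth bounded_linear_vec_nth] .
  have c_sums: "(\<lambda>k. ?c k * of_real y ^ k) sums (matexp (y *\<^sub>R G) $ i $ j)" for y :: real
    using bounded_linear.sums[OF entry matexp_sums[of "y *\<^sub>R G"]]
    by (simp add: matpow_scaleR scaleR_conv_of_real[where 'a=complex] field_simps)
  have d_sums: "(\<lambda>k. ?d k * of_real y ^ k) sums ((G ** matexp (y *\<^sub>R G)) $ i $ j)" for y :: real
    using bounded_linear.sums[OF bounded_linear_compose[OF entry
        bounded_bilinear.bounded_linear_right[OF bounded_bilinear_matrix_mult[where 'b='n], of G]] matexp_sums[of "y *\<^sub>R G"]]
    by (simp add: matpow_scaleR matrix_mult_scaleR_right scaleR_conv_of_real[where 'a=complex] field_simps)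
  have d: "diffs ?c k = ?d k" for k
    by (simp add: diffs_def del: of_nat_Suc)
  have sm: "summable (\<lambda>k. ?c k * z ^ k)" for z :: complex
  proof (rule powser_inside)
    show "summable (\<lambda>k. ?c k * of_real (norm z + 1) ^ k)"
      using c_sums[of "norm z + 1"] by (rule sums_summable)
    have "norm (of_real (norm z + 1) :: complex) = norm z + 1"
      by (simp only: norm_of_real) simp
    then show "norm z < norm (of_real (norm z + 1) :: complex)" by simp
  qed
  have "((\<lambda>z. \<Sum>k. ?c k * z ^ k) has_field_derivative (\<Sum>k. ?d k * of_real x ^ k)) (at (of_real x))"
    using termdiffs_strong_converges_everywhere[OF sm, of "of_real x"] unfolding d .
  then have "((\<lambda>y. \<Sum>k. ?c k * of_real y ^ k) has_vector_derivative (\<Sum>k. ?d k * of_real x ^ k)) (at x within S)"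
    by (rule has_vector_derivative_real_field)
  then show "((\<lambda>y. matexp (y *\<^sub>R G) $ i $ j) has_vector_derivative (G ** matexp (x *\<^sub>R G)) $ i $ j) (at x within S)"
    using c_sums d_sums by (simp add: sums_iff)
qed

text \<open>E(x) of the overview. The exponential of ix times \<open>cadj \<alpha>\<close> in the
  potential is the adjoint of the flow at -x, by \<open>cadj_flow\<close>.\<close>

definition flow :: "complex^'n^'n \<Rightarrow> real \<Rightarrow> complex^'n^'n" where
  "flow \<alpha> x = matexp ((\<i> * of_real x) *\<^sub>C \<alpha>)"

lemma flow_0 [simp]: "flow \<alpha> 0 = mat 1"
  by (simp add: flow_def)

lemma flow_eq: "flow \<alpha> x = matexp (x *\<^sub>R (\<i> *\<^sub>C \<alpha>))"
  by (simp add: flow_def smul_of_real[symmetric] mult.commute)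

lemma flow_commute: "\<alpha> ** flow \<alpha> x = flow \<alpha> x ** \<alpha>" for \<alpha> :: "complex^'n^'n"
proof (cases "x = 0")
  case False
  have "(\<i> * of_real x) *\<^sub>C (\<alpha> ** flow \<alpha> x) = (\<i> * of_real x) *\<^sub>C (flow \<alpha> x ** \<alpha>)"
    using matexp_commute[of "(\<i> * of_real x) *\<^sub>C \<alpha>"]
    by (simp add: flow_def smul_mult_left smul_mult_right)
  then have "(1 / (\<i> * of_real x)) *\<^sub>C (\<i> * of_real x) *\<^sub>C (\<alpha> ** flow \<alpha> x)
      = (1 / (\<i> * of_real x)) *\<^sub>C (\<i> * of_real x) *\<^sub>C (flow \<alpha> x ** \<alpha>)" by (rule arg_cong)
  then show ?thesis using False by simp
qed simp

lemma flow_has_vector_derivative: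
  "(flow \<alpha> has_vector_derivative \<i> *\<^sub>C (\<alpha> ** flow \<alpha> x)) (at x within S)"
  using matexp_scaleR_has_vector_derivative[of "\<i> *\<^sub>C \<alpha>" x S]
  by (simp add: flow_eq[abs_def] smul_mult_left)

lemma flow_affine_has_vector_derivative:
  "((\<lambda>x. flow \<alpha> (a * x + b)) has_vector_derivative (a * \<i>) *\<^sub>C (\<alpha> ** flow \<alpha> (a * x + b))) (at x within S)"
proof -
  have "((\<lambda>x. a * x + b) has_vector_derivative a) (at x within S)"
    by (auto intro!: derivative_eq_intros)
  from vector_diff_chain_within[OF this flow_has_vector_derivative[of \<alpha>]] show ?thesis
    by (simp add: o_def smul_of_real[symmetric])
qed

lemma flow_uminus_has_vector_derivative:
  "((\<lambda>x. flow \<alpha> (- x)) has_vector_derivative (- \<i>) *\<^sub>C (\<alpha> ** flow \<alpha> (- x))) (at x within S)"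
  using flow_affine_has_vector_derivative[of \<alpha> "-1" 0] by simp

lemmas has_vector_derivative_matrix_mult =
  bounded_bilinear.has_vector_derivative[OF bounded_bilinear_matrix_mult]
lemmas has_vector_derivative_cadj = bounded_linear.has_vector_derivative[OF bounded_linear_cadj]

text \<open>The derivative in x vanishes, so the product keeps its value at x = 0. The group law
  follows from this without multiplying series.\<close>

lemma flow_uminus_mult_flow: "flow \<alpha> (- x) ** flow \<alpha> (x + b) = flow \<alpha> b"
proof -
  let ?h = "\<lambda>x. flow \<alpha> (- x) ** flow \<alpha> (x + b)"
  have "(?h has_vector_derivative 0) (at x within UNIV)" for x
    by (rule has_vector_derivative_eq_rhs[OF has_vector_derivative_matrix_mult[OF
          flow_uminus_has_vector_derivative flow_affine_has_vector_derivative[of _ 1, simplified]]])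
      (simp add: smul_mult_left smul_mult_right flow_commute[of \<alpha> "- x"] smul_minus_left matrix_mult_minus_left
        matrix_mult_minus_right matrix_mul_assoc)
  then obtain c where "\<And>x. ?h x = c"
    using has_vector_derivative_zero_constant[of UNIV ?h] by auto
  from this[of x] this[of 0] show ?thesis by simp
qed

lemma flow_inverse: "flow \<alpha> (- x) ** flow \<alpha> x = mat 1" "flow \<alpha> x ** flow \<alpha> (- x) = mat 1"
  using flow_uminus_mult_flow[of \<alpha> x 0] flow_uminus_mult_flow[of \<alpha> "- x" 0] by simp_all

lemma flow_add: "flow \<alpha> (x + y) = flow \<alpha> x ** flow \<alpha> y"
proof -
  have "flow \<alpha> x ** flow \<alpha> y = (flow \<alpha> x ** flow \<alpha> (- x)) ** flow \<alpha> (x + y)"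
    by (simp add: matrix_mul_assoc[symmetric] flow_uminus_mult_flow)
  then show ?thesis by (simp add: flow_inverse)
qed

lemma cadj_flow: "cadj (flow \<alpha> x) = flow (cadj \<alpha>) (- x)"
  by (simp add: flow_def cadj_matexp cadj_smul)

lemma continuous_on_flow [continuous_intros]:
  assumes "continuous_on S f" "continuous_on S g"
  shows "continuous_on S (\<lambda>x. flow (f x) (g x))"
  unfolding flow_def by (intro continuous_intros assms)

lemma tendsto_flow [tendsto_intros]:
  assumes "(f \<longlongrightarrow> \<alpha>) F" "(g \<longlongrightarrow> x) F"
  shows "((\<lambda>k. flow (f k) (g k)) \<longlongrightarrow> flow \<alpha> x) F"
  unfolding flow_def by (intro tendsto_intros assms)

section \<open>The potential of a node\<close>

definition congr :: "complex^'n^'n \<Rightarrow> complex^'n^'n \<Rightarrow> complex^'n^'n" where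
  "congr F M = F ** M ** cadj F"

lemma congr_congr: "congr F (congr G M) = congr (F ** G) M"
  by (simp add: congr_def cadj_mult matrix_mul_assoc)

lemma congr_scaleR: "congr F (r *\<^sub>R M) = r *\<^sub>R congr F M"
  by (simp add: congr_def matrix_mult_scaleR_left matrix_mult_scaleR_right)

lemma cadj_congr: "cadj (congr F M) = congr F (cadj M)"
  by (simp add: congr_def cadj_mult matrix_mul_assoc)

lemma hermitian_congr: "hermitian M \<Longrightarrow> hermitian (congr F M)"
  by (simp add: hermitian_def cadj_congr)

lemma congr_one [simp]: "congr (mat 1) M = M"
  by (simp add: congr_def cadj_mat)

lemma inner_congr: "w \<bullet> (congr F M *v w) = (cadj F *v w) \<bullet> (M *v (cadj F *v w))"
  by (simp add: congr_def inner_mult_vec[of w] flip: matrix_vector_mul_assoc)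

lemma inner_congr_gram:
  "w \<bullet> (congr F (\<theta> ** cadj \<theta>) *v w) = (norm (cadj \<theta> *v (cadj F *v w)))\<^sup>2"
  by (simp add: inner_congr inner_mult_cadj)

lemma congr_matrix_inv:
  assumes "invertible M" "F ** G = mat 1"
  shows "matrix_inv (congr F M) = congr (cadj G) (matrix_inv M)"
proof (rule matrix_inv_unique)
  have 1: "cadj F ** cadj G = mat 1"
    using assms(2) matrix_left_right_inverse[of F G] by (simp add: cadj_mat flip: cadj_mult)
  have "congr F M ** congr (cadj G) (matrix_inv M) = F ** M ** (cadj F ** cadj G) ** matrix_inv M ** G"
    by (simp add: congr_def matrix_mul_assoc)
  also have "\<dots> = F ** (M ** matrix_inv M) ** G"
    unfolding 1 by (simp add: matrix_mul_assoc)
  also have "\<dots> = mat 1" by (simp add: matrix_inv_mult[OF assms(1)] assms(2))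
  finally show "congr F M ** congr (cadj G) (matrix_inv M) = mat 1" .
qed

lemma congr_flow_left: "\<alpha> ** congr (flow \<alpha> x) M = congr (flow \<alpha> x) (\<alpha> ** M)"
  by (simp add: congr_def matrix_mul_assoc flow_commute)

lemma congr_flow_right: "congr (flow \<alpha> x) M ** cadj \<alpha> = congr (flow \<alpha> x) (M ** cadj \<alpha>)"
proof -
  have "congr (flow \<alpha> x) M ** cadj \<alpha> = flow \<alpha> x ** M ** (cadj (flow \<alpha> x) ** cadj \<alpha>)"
    by (simp add: congr_def matrix_mul_assoc)
  also have "cadj (flow \<alpha> x) ** cadj \<alpha> = cadj \<alpha> ** cadj (flow \<alpha> x)"
    by (simp add: flow_commute flip: cadj_mult)
  finally show ?thesis by (simp add: congr_def matrix_mul_assoc)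
qed

lemma continuous_on_congr [continuous_intros]:
  "continuous_on S f \<Longrightarrow> continuous_on S g \<Longrightarrow> continuous_on S (\<lambda>x. congr (f x) (g x))"
  unfolding congr_def by (intro continuous_intros)

lemma tendsto_congr [tendsto_intros]:
  "(f \<longlongrightarrow> F) net \<Longrightarrow> (g \<longlongrightarrow> M) net \<Longrightarrow> ((\<lambda>x. congr (f x) (g x)) \<longlongrightarrow> congr F M) net"
  unfolding congr_def by (intro tendsto_intros)

text \<open>The flow contributes a commutator-like term, exactly the expression that the node
  identity evaluates. The factor a covers both time directions, a = 1 for \<open>R\<close> and a =
  -1 for \<open>R'\<close>.\<close>

lemma congr_flow_has_vector_derivative:
  assumes M: "(M has_vector_derivative M') (at x within S)"
  shows "((\<lambda>x. congr (flow \<alpha> (a * x)) (M x)) has_vector_derivative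
    congr (flow \<alpha> (a * x)) ((a * \<i>) *\<^sub>C (\<alpha> ** M x - M x ** cadj \<alpha>) + M')) (at x within S)"
proof -
  have F: "((\<lambda>x. flow \<alpha> (a * x)) has_vector_derivative (a * \<i>) *\<^sub>C (flow \<alpha> (a * x) ** \<alpha>)) (at x within S)"
    using flow_affine_has_vector_derivative[of \<alpha> a 0] by (simp add: flow_commute)
  show ?thesis
    unfolding congr_def
    by (rule has_vector_derivative_eq_rhs[OF has_vector_derivative_matrix_mult[OF
        has_vector_derivative_matrix_mult[OF F M] has_vector_derivative_cadj[OF F]]])
      (simp add: cadj_smul cadj_mult smul_mult_left smul_mult_right smul_diff smul_minus_left
        matrix_mult_add_left matrix_mult_add_right matrix_mult_diff_left matrix_mult_diff_right
        matrix_mult_minus_right matrix_mul_assoc)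
qed

lemma hcat_gram: "hcat M N ** cadj (hcat M N) = M ** cadj M + N ** cadj N"
  by (simp add: hcat_def cadj_def matrix_matrix_mult_def vec_eq_iff UNIV_sum sum.Plus[unfolded Plus_def]
      flip: UNIV_Plus_UNIV)

text \<open>\<open>S_fun\<close> integrates over \<open>{0..x}\<close>, which is empty for negative
  x; hence derivatives are taken within the half-line, one-sided at 0.\<close>

lemma has_vector_derivative_zero_half_line:
  fixes f :: "real \<Rightarrow> 'b::real_normed_vector"
  assumes "\<And>x. x \<ge> 0 \<Longrightarrow> (f has_vector_derivative 0) (at x within {0..})" "x \<ge> 0"
  shows "f x = f 0"
proof -
  obtain c where "\<And>x. x \<in> {0..} \<Longrightarrow> f x = c"
    using has_vector_derivative_zero_constant[of "{0..}" f] assms(1) by (auto simp: convex_real_interval)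
  then show ?thesis using assms(2) by simp
qed

lemma quadratic_form_mono:
  fixes M :: "real \<Rightarrow> complex^'n^'n"
  assumes M: "\<And>x. x \<ge> 0 \<Longrightarrow> (M has_vector_derivative M' x) (at x within {0..})"
    and nonneg: "\<And>x. x \<ge> 0 \<Longrightarrow> 0 \<le> w \<bullet> (M' x *v w)" and xy: "0 \<le> x" "x \<le> y"
  shows "w \<bullet> (M x *v w) \<le> w \<bullet> (M y *v w)"
proof (rule DERIV_nonneg_imp_increasing_open[OF xy(2)])
  have lin: "bounded_linear (\<lambda>M. w \<bullet> (M *v w))"
    by (intro bounded_linear_compose[OF bounded_linear_inner_right]
        bounded_bilinear.bounded_linear_left[OF bounded_bilinear_matrix_vector_mult])
  have d: "((\<lambda>x. w \<bullet> (M x *v w)) has_vector_derivative w \<bullet> (M' t *v w)) (at t within {0..})"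
    if "t \<ge> 0" for t
    using bounded_linear.has_vector_derivative[OF lin M[OF that]] .
  show "\<exists>l. DERIV (\<lambda>x. w \<bullet> (M x *v w)) t :> l \<and> 0 \<le> l" if "x < t" "t < y" for t
  proof -
    have "at t within {0..} = at t" using that xy by (intro at_within_interior) simp
    then show ?thesis using d[of t] nonneg[of t] that xy
      by (auto simp: has_real_derivative_iff_has_vector_derivative)
  qed
  show "continuous_on {x..y} (\<lambda>x. w \<bullet> (M x *v w))"
    unfolding continuous_on_eq_continuous_within
  proof
    fix t assume "t \<in> {x..y}"
    then show "continuous (at t within {x..y}) (\<lambda>x. w \<bullet> (M x *v w))"
      using xy by (intro continuous_within_subset[OF has_vector_derivative_continuous[OF d]]) auto
  qed
qed

text \<open>The constant c is a parameter, so that all members of a sequence and its limit can share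
  it.\<close>

locale node =
  fixes \<alpha> S0 :: "complex^'n^'n" and \<theta>1 :: "complex^'m1^'n" and \<theta>2 :: "complex^'m2^'n" and c :: real
  assumes herm: "hermitian S0" and coer: "coercive c S0" and c_pos: "c > 0"
    and node_identity: "\<alpha> ** S0 - S0 ** cadj \<alpha> = \<i> *\<^sub>C (\<theta>1 ** cadj \<theta>1 - \<theta>2 ** cadj \<theta>2)"
begin

text \<open>The factors -1 and 1 are written out to match the pattern \<open>a * x\<close> of
  \<open>congr_flow_has_vector_derivative\<close>.\<close>

abbreviation P1 :: "real \<Rightarrow> complex^'n^'n" where
  "P1 x \<equiv> congr (flow \<alpha> (- 1 * x)) (\<theta>1 ** cadj \<theta>1)"

abbreviation P2 :: "real \<Rightarrow> complex^'n^'n" where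
  "P2 x \<equiv> congr (flow \<alpha> (1 * x)) (\<theta>2 ** cadj \<theta>2)"

abbreviation S :: "real \<Rightarrow> complex^'n^'n" where
  "S \<equiv> S_fun \<alpha> S0 \<theta>1 \<theta>2"

text \<open>These two conjugates of S are monotone, while S enters the potential between the flows.\<close>

definition R :: "real \<Rightarrow> complex^'n^'n" where
  "R x = congr (flow \<alpha> (1 * x)) (S x)"

definition R' :: "real \<Rightarrow> complex^'n^'n" where
  "R' x = congr (flow \<alpha> (- 1 * x)) (S x)"

lemma S_eq: "S x = S0 + integral {0..x} (\<lambda>t. P1 t + P2 t)"
proof -
  have "Lambda_fun \<alpha> \<theta>1 \<theta>2 t ** cadj (Lambda_fun \<alpha> \<theta>1 \<theta>2 t) = P1 t + P2 t" for t
    by (simp add: Lambda_fun_def hcat_gram congr_def flow_def cadj_mult matrix_mul_assoc)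
  then show ?thesis by (simp add: S_fun_def)
qed

lemma S_0 [simp]: "S 0 = S0"
  by (simp add: S_eq)

lemma continuous_on_P: "continuous_on T (\<lambda>t. P1 t + P2 t)"
  by (intro continuous_intros)

lemma S_has_vector_derivative:
  assumes "x \<ge> 0"
  shows "(S has_vector_derivative P1 x + P2 x) (at x within {0..})"
proof -
  \<comment> \<open>The fundamental theorem needs a compact interval; reaching beyond x makes its
    filter at x agree with that of the half-line.\<close>
  have "((\<lambda>u. integral {0..u} (\<lambda>t. P1 t + P2 t)) has_vector_derivative P1 x + P2 x) (at x within {0..x + 1})"
    by (rule integral_has_vector_derivative[OF continuous_on_P]) (use assms in auto)
  then have "(S has_vector_derivative P1 x + P2 x) (at x within {0..x + 1})"
    unfolding S_eq[abs_def] by (auto intro!: derivative_eq_intros)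
  moreover have "at x within {0..x + 1} = at x within {0..}"
    by (rule at_within_nhd[of x "{..<x + 1}"]) auto
  ultimately show ?thesis by simp
qed

lemma hermitian_S: "hermitian (S x)"
proof -
  have "(\<lambda>t. P1 t + P2 t) integrable_on {0..x}"
    by (rule integrable_continuous_interval[OF continuous_on_P])
  from integral_linear[OF this bounded_linear_cadj]
  have "cadj (integral {0..x} (\<lambda>t. P1 t + P2 t)) = integral {0..x} (\<lambda>t. P1 t + P2 t)"
    by (simp add: o_def cadj_add cadj_congr cadj_mult)
  then show ?thesis using herm by (simp add: hermitian_def S_eq cadj_add)
qed

lemma coercive_S:
  assumes "x \<ge> 0"
  shows "coercive c (S x)"
  unfolding coercive_def
proof
  fix w
  have "w \<bullet> (S 0 *v w) \<le> w \<bullet> (S x *v w)"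
    by (rule quadratic_form_mono[OF S_has_vector_derivative])
      (use assms in \<open>simp_all add: matrix_vector_mult_add_rdistrib inner_add_right inner_congr_gram\<close>)
  then show "c * (norm w)\<^sup>2 \<le> w \<bullet> (S x *v w)"
    using coer by (auto simp: coercive_def intro: order_trans)
qed

text \<open>The node identity persists along x. Differentiating the flows in i (P1 - P2) gives
  \<open>?D\<close> of P1 + P2, which is also the derivative of the left side; so the defect J keeps
  its value 0 from x = 0.\<close>

lemma S_identity:
  assumes "x \<ge> 0"
  shows "\<alpha> ** S x - S x ** cadj \<alpha> = \<i> *\<^sub>C (P1 x - P2 x)"
proof -
  define J where "J = (\<lambda>x. \<alpha> ** S x - S x ** cadj \<alpha> - \<i> *\<^sub>C (P1 x - P2 x))"
  let ?D = "\<lambda>M. \<alpha> ** M - M ** cadj \<alpha>"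
  have "(J has_vector_derivative 0) (at x within {0..})" if "x \<ge> 0" for x
  proof -
    let ?F = "at x within {0..}"
    have P1: "(P1 has_vector_derivative (- \<i>) *\<^sub>C ?D (P1 x)) ?F"
      using congr_flow_has_vector_derivative[OF has_vector_derivative_const, of \<alpha> "- 1" "\<theta>1 ** cadj \<theta>1" x "{0..}"]
      by (simp add: congr_flow_left congr_flow_right smul_minus_left)
        (simp add: congr_def smul_mult_left smul_mult_right smul_diff matrix_mult_diff_left
          matrix_mult_diff_right matrix_mult_minus_left matrix_mult_minus_right)
    have P2: "(P2 has_vector_derivative \<i> *\<^sub>C ?D (P2 x)) ?F"
      using congr_flow_has_vector_derivative[OF has_vector_derivative_const, of \<alpha> 1 "\<theta>2 ** cadj \<theta>2" x "{0..}"]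
      by (simp add: congr_flow_left congr_flow_right)
        (simp add: congr_def smul_mult_left smul_mult_right smul_diff matrix_mult_diff_left
          matrix_mult_diff_right)
    have aS: "((\<lambda>x. \<alpha> ** S x) has_vector_derivative \<alpha> ** (P1 x + P2 x)) ?F"
      by (rule bounded_linear.has_vector_derivative[OF bounded_bilinear.bounded_linear_right[OF
            bounded_bilinear_matrix_mult] S_has_vector_derivative[OF that]])
    have Sa: "((\<lambda>x. S x ** cadj \<alpha>) has_vector_derivative (P1 x + P2 x) ** cadj \<alpha>) ?F"
      by (rule bounded_linear.has_vector_derivative[OF bounded_bilinear.bounded_linear_left[OF
            bounded_bilinear_matrix_mult] S_has_vector_derivative[OF that]])
    have iP: "((\<lambda>x. \<i> *\<^sub>C (P1 x - P2 x)) has_vector_derivative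
        \<i> *\<^sub>C ((- \<i>) *\<^sub>C ?D (P1 x) - \<i> *\<^sub>C ?D (P2 x))) ?F"
      by (rule bounded_linear.has_vector_derivative[OF bounded_bilinear.bounded_linear_right[OF
            bounded_bilinear_smul] has_vector_derivative_diff[OF P1 P2]])
    show ?thesis
      unfolding J_def
      by (rule has_vector_derivative_eq_rhs[OF has_vector_derivative_diff[OF
            has_vector_derivative_diff[OF aS Sa] iP]])
        (simp add: smul_diff smul_minus_left matrix_mult_add_left matrix_mult_add_right)
  qed
  then have "J x = J 0" using assms by (rule has_vector_derivative_zero_half_line)
  also have "J 0 = 0" using node_identity by (simp add: J_def)
  finally show ?thesis by (simp add: J_def)
qed

lemma congr_flow_flow: "congr (flow \<alpha> x) (congr (flow \<alpha> y) M) = congr (flow \<alpha> (x + y)) M"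
  by (simp add: congr_congr flow_add)

text \<open>\<open>S_identity\<close> evaluates the term coming from the flow as P2 - P1. It cancels
  P1 in the derivative of S and leaves 2 P2, and the conjugation doubles the time. For
  \<open>R'\<close> the signs are exchanged and 2 P1 remains.\<close>

lemma R_has_vector_derivative:
  assumes "x \<ge> 0"
  shows "(R has_vector_derivative 2 *\<^sub>R congr (flow \<alpha> (2 * x)) (\<theta>2 ** cadj \<theta>2)) (at x within {0..})"
proof -
  have "\<i> *\<^sub>C (\<alpha> ** S x - S x ** cadj \<alpha>) + (P1 x + P2 x) = 2 *\<^sub>R P2 x"
    by (simp add: S_identity[OF assms] smul_minus_left scaleR_2)
  then show ?thesis
    using congr_flow_has_vector_derivative[OF S_has_vector_derivative[OF assms], of \<alpha> 1]
    by (simp add: R_def[abs_def] congr_scaleR congr_flow_flow)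
qed

lemma R'_has_vector_derivative:
  assumes "x \<ge> 0"
  shows "(R' has_vector_derivative 2 *\<^sub>R congr (flow \<alpha> (- 2 * x)) (\<theta>1 ** cadj \<theta>1)) (at x within {0..})"
proof -
  have "(- \<i>) *\<^sub>C (\<alpha> ** S x - S x ** cadj \<alpha>) + (P1 x + P2 x) = 2 *\<^sub>R P1 x"
    by (simp add: S_identity[OF assms] scaleR_2)
  then show ?thesis
    using congr_flow_has_vector_derivative[OF S_has_vector_derivative[OF assms], of \<alpha> "- 1"]
    by (simp add: R'_def[abs_def] congr_scaleR congr_flow_flow)
qed

lemma R_0 [simp]: "R 0 = S0" and R'_0 [simp]: "R' 0 = S0"
  by (simp_all add: R_def R'_def)

lemma R_mono:
  assumes "0 \<le> x" "x \<le> y"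
  shows "w \<bullet> (R x *v w) \<le> w \<bullet> (R y *v w)"
  by (rule quadratic_form_mono[OF R_has_vector_derivative _ assms])
    (simp_all add: bounded_bilinear.scaleR_left[OF bounded_bilinear_matrix_vector_mult] inner_congr_gram)

lemma R'_mono:
  assumes "0 \<le> x" "x \<le> y"
  shows "w \<bullet> (R' x *v w) \<le> w \<bullet> (R' y *v w)"
  by (rule quadratic_form_mono[OF R'_has_vector_derivative _ assms])
    (simp_all add: bounded_bilinear.scaleR_left[OF bounded_bilinear_matrix_vector_mult] inner_congr_gram)

lemma R_nonneg:
  assumes "x \<ge> 0"
  shows "0 \<le> w \<bullet> (R x *v w)"
proof -
  have "0 \<le> c * (norm w)\<^sup>2" using c_pos by simp
  also have "\<dots> \<le> w \<bullet> (R 0 *v w)" using coer by (simp add: coercive_def)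
  also have "\<dots> \<le> w \<bullet> (R x *v w)" by (rule R_mono) (use assms in auto)
  finally show ?thesis .
qed

lemma coercive_R':
  assumes "x \<ge> 0"
  shows "coercive c (R' x)"
  using coer R'_mono[OF order_refl assms] by (auto simp: coercive_def intro: order_trans)

lemma coercive_R_mono: "coercive K (R x) \<Longrightarrow> 0 \<le> x \<Longrightarrow> x \<le> y \<Longrightarrow> coercive K (R y)"
  using R_mono by (auto simp: coercive_def intro: order_trans)

text \<open>
  Cauchy-Schwarz for the inverse of S; conjugating by the flows turns the two factors into
  quadratic forms of the inverses of R and R'.
\<close>

lemma potential_bound:
  assumes x: "x \<ge> 0" and K: "coercive K (R x)" "K > 0"
  shows "opnorm (pseudo_exp_potential \<alpha> S0 \<theta>1 \<theta>2 x) \<le> 2 * opnorm \<theta>1 * opnorm \<theta>2 / sqrt (K * c)"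
proof -
  let ?S = "matrix_inv (S x)"
  let ?M = "cadj \<theta>1 ** cadj (flow \<alpha> (- x)) ** ?S ** flow \<alpha> x ** \<theta>2"
  have iS: "invertible (S x)" using coercive_invertible[OF coercive_S[OF x] c_pos] .
  have psd: "0 \<le> w \<bullet> (?S *v w)" for w using coercive_inv_nonneg[OF coercive_S[OF x] c_pos] .
  have iR: "matrix_inv (R x) = congr (cadj (flow \<alpha> (- x))) ?S"
    unfolding R_def by (rule congr_matrix_inv[OF iS]) (simp add: flow_inverse)
  have iR': "matrix_inv (R' x) = congr (cadj (flow \<alpha> x)) ?S"
    unfolding R'_def by (rule congr_matrix_inv[OF iS]) (simp add: flow_inverse)
  have v: "pseudo_exp_potential \<alpha> S0 \<theta>1 \<theta>2 x = (- 2 * \<i>) *\<^sub>C ?M"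
    by (simp add: pseudo_exp_potential_def cadj_flow) (simp add: flow_def)
  have M: "norm (?M *v w) \<le> opnorm \<theta>1 * opnorm \<theta>2 / sqrt (K * c) * norm w" for w
  proof -
    \<comment> \<open>Pairing the image with itself turns its squared norm into a form of the
      inverse of S between two different vectors.\<close>
    define y where "y = ?M *v w"
    \<comment> \<open>The form at \<open>?p\<close> is that of the inverse of R at
      \<open>\<theta>1 *v y\<close>, hence the factor 1/K; the form at \<open>?q\<close> is that of
      the inverse of \<open>R'\<close> at \<open>\<theta>2 *v w\<close>, hence 1/c.\<close>
    let ?p = "flow \<alpha> (- x) *v (\<theta>1 *v y)" and ?q = "flow \<alpha> x *v (\<theta>2 *v w)"
    have "(norm y)\<^sup>2 = y \<bullet> (?M *v w)" by (simp add: y_def power2_norm_eq_inner)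
    also have "\<dots> = ?p \<bullet> (?S *v ?q)"
      by (simp add: inner_mult_vec[of y] inner_mult_vec[of "\<theta>1 *v y"] flip: matrix_vector_mul_assoc)
    finally have y2: "(norm y)\<^sup>2 = ?p \<bullet> (?S *v ?q)" .
    have p: "?p \<bullet> (?S *v ?p) \<le> (opnorm \<theta>1 * norm y)\<^sup>2 / K"
    proof -
      have "?p \<bullet> (?S *v ?p) = (\<theta>1 *v y) \<bullet> (matrix_inv (R x) *v (\<theta>1 *v y))"
        by (simp add: iR inner_congr)
      also have "\<dots> \<le> (norm (\<theta>1 *v y))\<^sup>2 / K" by (rule coercive_inv_le[OF K])
      also have "\<dots> \<le> (opnorm \<theta>1 * norm y)\<^sup>2 / K"
        using K(2) by (intro divide_right_mono power_mono norm_mult_vec_le_opnorm) auto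
      finally show ?thesis .
    qed
    have q: "?q \<bullet> (?S *v ?q) \<le> (opnorm \<theta>2 * norm w)\<^sup>2 / c"
    proof -
      have "?q \<bullet> (?S *v ?q) = (\<theta>2 *v w) \<bullet> (matrix_inv (R' x) *v (\<theta>2 *v w))"
        by (simp add: iR' inner_congr)
      also have "\<dots> \<le> (norm (\<theta>2 *v w))\<^sup>2 / c" by (rule coercive_inv_le[OF coercive_R'[OF x] c_pos])
      also have "\<dots> \<le> (opnorm \<theta>2 * norm w)\<^sup>2 / c"
        using c_pos by (intro divide_right_mono power_mono norm_mult_vec_le_opnorm) auto
      finally show ?thesis .
    qed
    have "((norm y)\<^sup>2)\<^sup>2 \<le> (?p \<bullet> (?S *v ?p)) * (?q \<bullet> (?S *v ?q))"
      unfolding y2 by (rule psd_cauchy_schwarz[OF hermitian_matrix_inv[OF iS hermitian_S] psd])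
    also have "\<dots> \<le> ((opnorm \<theta>1 * norm y)\<^sup>2 / K) * ((opnorm \<theta>2 * norm w)\<^sup>2 / c)"
      using K(2) by (intro mult_mono p q psd) simp
    also have "\<dots> = (norm y * (opnorm \<theta>1 * opnorm \<theta>2 / sqrt (K * c) * norm w))\<^sup>2"
      using K(2) c_pos by (simp add: power_mult_distrib power_divide)
    finally have "(norm y)\<^sup>2 \<le> norm y * (opnorm \<theta>1 * opnorm \<theta>2 / sqrt (K * c) * norm w)"
      by (rule power2_le_imp_le) (use K(2) c_pos in \<open>simp add: opnorm_nonneg\<close>)
    then have "norm y \<le> opnorm \<theta>1 * opnorm \<theta>2 / sqrt (K * c) * norm w"
    proof (cases "y = 0")
      case True
      then show ?thesis using K(2) c_pos by (simp add: opnorm_nonneg)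
    next
      case False
      assume "(norm y)\<^sup>2 \<le> norm y * (opnorm \<theta>1 * opnorm \<theta>2 / sqrt (K * c) * norm w)"
      then show ?thesis
        unfolding power2_eq_square by (rule mult_left_le_imp_le) (use False in simp)
    qed
    then show ?thesis by (simp only: y_def)
  qed
  show ?thesis
    unfolding v opnorm_def[of "(- 2 * \<i>) *\<^sub>C ?M"]
  proof (rule onorm_le)
    fix w
    show "norm ((- 2 * \<i>) *\<^sub>C ?M *v w) \<le> 2 * opnorm \<theta>1 * opnorm \<theta>2 / sqrt (K * c) * norm w"
      using M[of w] by (simp add: smul_mult_vec norm_cscale norm_mult)
  qed
qed

section \<open>Growth of R in every direction\<close>

definition bounded_directions :: "(complex^'n) set" where
  "bounded_directions = {w. \<exists>K. \<forall>x\<ge>0. w \<bullet> (R x *v w) \<le> K}"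

text \<open>Parallelogram law, with the nonnegative form at u - w dropped.\<close>

lemma bounded_directions_add:
  assumes "u \<in> bounded_directions" "w \<in> bounded_directions"
  shows "u + w \<in> bounded_directions"
proof -
  obtain K L where K: "\<And>x. x \<ge> 0 \<Longrightarrow> u \<bullet> (R x *v u) \<le> K" and L: "\<And>x. x \<ge> 0 \<Longrightarrow> w \<bullet> (R x *v w) \<le> L"
    using assms unfolding bounded_directions_def by blast
  have "(u + w) \<bullet> (R x *v (u + w)) \<le> 2 * K + 2 * L" if "x \<ge> 0" for x
  proof -
    have "0 \<le> (u - w) \<bullet> (R x *v (u - w))" using R_nonneg[OF that] .
    then have "(u + w) \<bullet> (R x *v (u + w)) \<le> 2 * (u \<bullet> (R x *v u)) + 2 * (w \<bullet> (R x *v w))"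
      by (simp add: matrix_vector_mult_diff_distrib matrix_vector_right_distrib inner_diff_left
          inner_diff_right inner_add_left inner_add_right)
    then show ?thesis using K[OF that] L[OF that] by linarith
  qed
  then show ?thesis unfolding bounded_directions_def by blast
qed

lemma bounded_directions_cscale:
  assumes "w \<in> bounded_directions"
  shows "a *s w \<in> bounded_directions"
proof -
  obtain K where K: "\<And>x. x \<ge> 0 \<Longrightarrow> w \<bullet> (R x *v w) \<le> K"
    using assms unfolding bounded_directions_def by blast
  have "(a *s w) \<bullet> (R x *v (a *s w)) \<le> (norm a)\<^sup>2 * K" if "x \<ge> 0" for x
    using K[OF that] by (simp add: mult_vec_cscale inner_cscale_cscale mult_left_mono)
  then show ?thesis unfolding bounded_directions_def by blast
qed

lemma subspace_bounded_directions: "subspace bounded_directions"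
  unfolding subspace_def
  using bounded_directions_add bounded_directions_cscale[of _ "of_real _"]
  by (auto simp: cscale_of_real) (auto simp: bounded_directions_def)

text \<open>R(x + s) and the conjugate of R(x) by the flow at 2s have the same derivative in x, so
  they differ by a constant matrix. A bound for R at w therefore bounds R at the moved
  vector.\<close>

lemma bounded_directions_flow:
  assumes s: "s \<ge> 0" and w: "w \<in> bounded_directions"
  shows "cadj (flow \<alpha> (2 * s)) *v w \<in> bounded_directions"
proof -
  let ?E = "flow \<alpha> (2 * s)"
  obtain K where K: "\<And>x. x \<ge> 0 \<Longrightarrow> w \<bullet> (R x *v w) \<le> K"
    using w unfolding bounded_directions_def by blast
  define H where "H = (\<lambda>x. R (x + s) - congr ?E (R x))"
  have "(H has_vector_derivative 0) (at x within {0..})" if "x \<ge> 0" for x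
  proof -
    have "((\<lambda>x. x + s) has_vector_derivative 1) (at x within {0..})"
      by (auto intro!: derivative_eq_intros)
    moreover have "(R has_vector_derivative 2 *\<^sub>R congr (flow \<alpha> (2 * (x + s))) (\<theta>2 ** cadj \<theta>2))
        (at (x + s) within (\<lambda>x. x + s) ` {0..})"
      by (rule has_vector_derivative_within_subset[OF R_has_vector_derivative]) (use that s in auto)
    ultimately have 1: "((\<lambda>x. R (x + s)) has_vector_derivative
        2 *\<^sub>R congr (flow \<alpha> (2 * (x + s))) (\<theta>2 ** cadj \<theta>2)) (at x within {0..})"
      using vector_diff_chain_within[of "\<lambda>x. x + s"] by (fastforce simp: o_def)
    have lin: "bounded_linear (congr ?E)"
      unfolding congr_def
      by (intro bounded_linear_compose[OF bounded_bilinear.bounded_linear_left[OF bounded_bilinear_matrix_mult]]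
          bounded_bilinear.bounded_linear_right[OF bounded_bilinear_matrix_mult])
    have 2: "((\<lambda>x. congr ?E (R x)) has_vector_derivative
        congr ?E (2 *\<^sub>R congr (flow \<alpha> (2 * x)) (\<theta>2 ** cadj \<theta>2))) (at x within {0..})"
      by (rule bounded_linear.has_vector_derivative[OF lin R_has_vector_derivative[OF that]])
    show ?thesis
      unfolding H_def
      by (rule has_vector_derivative_eq_rhs[OF has_vector_derivative_diff[OF 1 2]])
        (simp add: congr_scaleR congr_flow_flow algebra_simps)
  qed
  then have H0: "H x = H 0" if "x \<ge> 0" for x using that by (rule has_vector_derivative_zero_half_line)
  have "congr ?E (R x) = R (x + s) - H x" for x by (simp add: H_def)
  then have "congr ?E (R x) = R (x + s) - H 0" if "x \<ge> 0" for x
    unfolding H0[OF that, symmetric] .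
  then have "(cadj ?E *v w) \<bullet> (R x *v (cadj ?E *v w)) \<le> K - w \<bullet> (H 0 *v w)" if "x \<ge> 0" for x
    using K[of "x + s"] that s
    by (simp add: matrix_vector_mult_diff_rdistrib inner_diff_right flip: inner_congr)
  then show ?thesis unfolding bounded_directions_def by blast
qed

text \<open>Differentiates the flow invariance at 0. The derivative stays in the subspace because
  this equals its double orthogonal complement: a vector orthogonal to it annihilates the whole
  curve, hence also its derivative.\<close>

lemma bounded_directions_invariant:
  assumes w: "w \<in> bounded_directions"
  shows "cadj \<alpha> *v w \<in> bounded_directions"
proof -
  let ?V = bounded_directions
  let ?g = "\<lambda>s. flow (cadj \<alpha>) (- s) *v w"
  let ?d = "(- \<i>) *s (cadj \<alpha> *v w)"
  have g: "?g s \<in> ?V" if "s \<ge> 0" for s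
    using bounded_directions_flow[OF _ w, of "s / 2"] that by (simp add: cadj_flow)
  have dg: "(?g has_vector_derivative ?d) (at 0 within {0..1})"
    using bounded_linear.has_vector_derivative[OF bounded_bilinear.bounded_linear_left[OF
        bounded_bilinear_matrix_vector_mult] flow_uminus_has_vector_derivative[of "cadj \<alpha>" 0 "{0..1}"], of w]
    by (simp add: smul_mult_vec)
  have "z \<bullet> ?d = 0" if z: "z \<in> ?V\<^sup>\<bottom>" for z
  proof (rule vector_derivative_unique_within)
    show "at (0::real) within {0..1} \<noteq> bot" by (simp add: at_within_Icc_at_right)
    show "((\<lambda>s. z \<bullet> ?g s) has_vector_derivative z \<bullet> ?d) (at 0 within {0..1})"
      by (rule bounded_linear.has_vector_derivative[OF bounded_linear_inner_right dg])
    have "z \<bullet> ?g s = 0" if "s \<in> {0..1}" for s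
      using z g[of s] that by (auto simp: orthogonal_comp_def orthogonal_def inner_commute)
    then show "((\<lambda>s. z \<bullet> ?g s) has_vector_derivative 0) (at 0 within {0..1})"
      by (intro has_vector_derivative_transform[OF _ _ has_vector_derivative_const[of 0]]) auto
  qed
  then have "?d \<in> ?V\<^sup>\<bottom>\<^sup>\<bottom>"
    by (auto simp: orthogonal_comp_def[of "?V\<^sup>\<bottom>"] orthogonal_def inner_commute)
  then have "?d \<in> ?V" by (simp add: orthogonal_comp_self subspace_bounded_directions)
  from bounded_directions_cscale[OF this, of \<i>] show ?thesis by (simp add: vector_smult_assoc)
qed

text \<open>Otherwise \<open>cadj \<alpha>\<close> has an eigenvector u there, with eigenvalue in
  the closed upper half-plane. The adjoint flow multiplies u by scalars of modulus at least 1, so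
  the form of R at u grows at least linearly unless \<open>cadj \<theta>2 *v u = 0\<close>, which
  \<open>ctrl\<close> excludes.\<close>

lemma bounded_directions_trivial:
  assumes sp: "spectrum \<alpha> \<subseteq> {z. Im z \<le> 0}"
    and ctrl: "\<And>\<mu> w. 0 \<le> Im \<mu> \<Longrightarrow> cadj \<alpha> *v w = \<mu> *s w \<Longrightarrow> cadj \<theta>2 *v w = 0 \<Longrightarrow> w = 0"
    and w: "w \<in> bounded_directions"
  shows "w = 0"
proof (rule ccontr)
  assume "w \<noteq> 0"
  then obtain \<mu> u where u: "u \<in> bounded_directions" "u \<noteq> 0" "cadj \<alpha> *v u = \<mu> *s u"
    using eigenvector_in_invariant_subspace[of bounded_directions "cadj \<alpha>" w]
      bounded_directions_add bounded_directions_cscale bounded_directions_invariant w by metis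
  have "\<mu> \<in> spectrum (cadj \<alpha>)" using u spectrum_iff_eigenvector by blast
  then have "Im (cnj \<mu>) \<le> 0" using spectrum_cadj sp by blast
  then have im: "0 \<le> Im \<mu>" by simp
  let ?n = "(norm (cadj \<theta>2 *v u))\<^sup>2"
  obtain K where K: "\<And>x. x \<ge> 0 \<Longrightarrow> u \<bullet> (R x *v u) \<le> K"
    using u(1) unfolding bounded_directions_def by blast
  have ev: "cadj (flow \<alpha> y) *v u = exp (- \<i> * of_real y * \<mu>) *s u" for y
  proof -
    have "((\<i> * of_real (- y)) *\<^sub>C cadj \<alpha>) *v u = (- \<i> * of_real y * \<mu>) *s u"
      by (simp add: smul_mult_vec u(3) vector_smult_assoc)
    from matexp_eigenvector[OF this] show ?thesis unfolding cadj_flow unfolding flow_def .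
  qed
  have lower: "2 * x * ?n \<le> u \<bullet> (R x *v u)" if "x \<ge> 0" for x
  proof -
    \<comment> \<open>R minus the claimed linear growth: its form at u is still
      nondecreasing.\<close>
    let ?M = "\<lambda>x. R x - x *\<^sub>R (2 *\<^sub>R (\<theta>2 ** cadj \<theta>2))"
    let ?M' = "\<lambda>x. 2 *\<^sub>R congr (flow \<alpha> (2 * x)) (\<theta>2 ** cadj \<theta>2) - 2 *\<^sub>R (\<theta>2 ** cadj \<theta>2)"
    have "u \<bullet> (?M 0 *v u) \<le> u \<bullet> (?M x *v u)"
    proof (rule quadratic_form_mono[where M' = ?M'])
      fix t :: real assume t: "t \<ge> 0"
      have "((\<lambda>x. x *\<^sub>R (2 *\<^sub>R (\<theta>2 ** cadj \<theta>2))) has_vector_derivative 2 *\<^sub>R (\<theta>2 ** cadj \<theta>2)) (at t within {0..})"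
        by (auto intro!: derivative_eq_intros)
      then show "(?M has_vector_derivative ?M' t) (at t within {0..})"
        by (rule has_vector_derivative_diff[OF R_has_vector_derivative[OF t]])
      let ?e = "exp (- \<i> * of_real (2 * t) * \<mu>)"
      have "norm ?e = exp (2 * t * Im \<mu>)" by simp
      then have "1 \<le> norm ?e" using t im by simp
      then have "?n \<le> (norm (?e *s (cadj \<theta>2 *v u)))\<^sup>2"
        by (intro power_mono) (simp_all only: norm_cscale, simp_all add: mult_le_cancel_right1)
      then show "0 \<le> u \<bullet> (?M' t *v u)"
        by (simp only: matrix_vector_mult_diff_rdistrib inner_diff_right inner_congr_gram ev mult_vec_cscale
            inner_mult_cadj bounded_bilinear.scaleR_left[OF bounded_bilinear_matrix_vector_mult] inner_scaleR_right)
    qed (use that in auto)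
    then have "u \<bullet> (S0 *v u) + 2 * x * ?n \<le> u \<bullet> (R x *v u)"
      by (simp add: matrix_vector_mult_diff_rdistrib inner_diff_right inner_mult_cadj
          bounded_bilinear.scaleR_left[OF bounded_bilinear_matrix_vector_mult])
    then show ?thesis using R_nonneg[of 0 u] by simp
  qed
  have "?n = 0"
  proof (rule ccontr)
    assume "?n \<noteq> 0"
    then have n: "?n > 0" by simp
    \<comment> \<open>Chosen so that the lower bound becomes 2 (|K| + 1), which exceeds K.\<close>
    define x where "x = (\<bar>K\<bar> + 1) / ?n"
    have "x \<ge> 0" using n by (simp add: x_def)
    then have "2 * x * ?n \<le> K" using lower K order_trans by blast
    then show False using n by (simp add: x_def)
  qed
  then show False using ctrl[OF im u(3)] u(2) by simp
qed

text \<open>Compactness makes the growth uniform. If every T failed, unit vectors w_j with form of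
  R(j) below K would accumulate at some l; by monotonicity the form of R(T) at w_j is below K once j
  exceeds T, so l would be a bounded direction.\<close>

lemma R_unbounded:
  assumes sp: "spectrum \<alpha> \<subseteq> {z. Im z \<le> 0}"
    and ctrl: "\<And>\<mu> w. 0 \<le> Im \<mu> \<Longrightarrow> cadj \<alpha> *v w = \<mu> *s w \<Longrightarrow> cadj \<theta>2 *v w = 0 \<Longrightarrow> w = 0"
  obtains T where "T \<ge> 0" "coercive K (R T)"
proof (rule ccontr)
  assume "\<not> thesis"
  then have nc: "\<not> coercive K (R T)" if "T \<ge> 0" for T using that \<open>\<And>T. 0 \<le> T \<Longrightarrow> coercive K (R T) \<Longrightarrow> thesis\<close> by blast
  have "\<exists>w. norm w = 1 \<and> w \<bullet> (R (real j) *v w) < K" for j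
    using nc[of "real j"] quadratic_form_scale[of K "R (real j)"]
    unfolding coercive_def by (meson not_le of_nat_0_le_iff)
  then obtain w where w: "\<And>j. norm (w j) = 1" "\<And>j. w j \<bullet> (R (real j) *v w j) < K" by metis
  then have "\<And>j. w j \<in> sphere 0 1" by simp
  then obtain l s where l: "l \<in> sphere 0 1" and s: "strict_mono s" and lim: "(w \<circ> s) \<longlonglongrightarrow> l"
    using compact_sphere[of "0::complex^'n" 1] unfolding compact_def by metis
  have "l \<bullet> (R T *v l) \<le> K" if "T \<ge> 0" for T
  proof (rule LIMSEQ_le_const2)
    show "(\<lambda>j. w (s j) \<bullet> (R T *v w (s j))) \<longlonglongrightarrow> l \<bullet> (R T *v l)"
      using lim by (intro tendsto_intros) (simp_all add: o_def)
    show "\<exists>N. \<forall>j\<ge>N. w (s j) \<bullet> (R T *v w (s j)) \<le> K"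
    proof (intro exI allI impI)
      fix j assume "nat \<lceil>T\<rceil> \<le> j"
      then have "T \<le> real (s j)" using seq_suble[OF s, of j] by linarith
      then show "w (s j) \<bullet> (R T *v w (s j)) \<le> K"
        using R_mono[OF that, of "real (s j)" "w (s j)"] w(2)[of "s j"] by linarith
    qed
  qed
  then have "l \<in> bounded_directions" by (auto simp: bounded_directions_def)
  then have "l = 0" using bounded_directions_trivial[OF sp] ctrl by blast
  then show False using l by simp
qed

text \<open>The substitution t = x s moves x from the domain of integration into the integrand, so
  that continuity of parameter integrals covers x as well.\<close>

lemma S_eq_integral:
  assumes "x \<ge> 0"
  shows "S x = S0 + integral {0..1} (\<lambda>s. x *\<^sub>R (P1 (x * s) + P2 (x * s)))"
proof -
  have "((\<lambda>s. x *\<^sub>R (P1 (x * s) + P2 (x * s))) has_integral S (x * 1) - S (x * 0)) {0..1}"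
  proof (rule fundamental_theorem_of_calculus)
    fix s :: real assume s: "s \<in> {0..1}"
    have "((\<lambda>s. x * s) has_vector_derivative x) (at s within {0..1})"
      by (auto intro!: derivative_eq_intros)
    moreover have "(S has_vector_derivative P1 (x * s) + P2 (x * s)) (at (x * s) within (\<lambda>s. x * s) ` {0..1})"
      by (rule has_vector_derivative_within_subset[OF S_has_vector_derivative]) (use s assms in auto)
    ultimately show "((\<lambda>s. S (x * s)) has_vector_derivative x *\<^sub>R (P1 (x * s) + P2 (x * s))) (at s within {0..1})"
      using vector_diff_chain_within[of "\<lambda>s. x * s"] by (fastforce simp: o_def)
  qed simp
  from integral_unique[OF this] show ?thesis by simp
qed

end

section \<open>Convergence of potentials\<close>

lemma S_fun_tendsto:
  fixes \<alpha> :: "nat \<Rightarrow> complex^'n^'n" and \<theta>1 :: "nat \<Rightarrow> complex^'m1^'n" and \<theta>2 :: "nat \<Rightarrow> complex^'m2^'n"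
  assumes lims: "\<alpha> \<longlonglongrightarrow> \<alpha>0" "S0 \<longlonglongrightarrow> T0" "\<theta>1 \<longlonglongrightarrow> \<tau>1" "\<theta>2 \<longlonglongrightarrow> \<tau>2" "x \<longlonglongrightarrow> y"
    and x: "\<And>k. x k \<ge> 0"
    and nodes: "\<And>k. node (\<alpha> k) (S0 k) (\<theta>1 k) (\<theta>2 k) c" and node0: "node \<alpha>0 T0 \<tau>1 \<tau>2 c"
  shows "(\<lambda>k. S_fun (\<alpha> k) (S0 k) (\<theta>1 k) (\<theta>2 k) (x k)) \<longlonglongrightarrow> S_fun \<alpha>0 T0 \<tau>1 \<tau>2 y"
proof -
  define f where "f = (\<lambda>(\<alpha>::complex^'n^'n, \<theta>1::complex^'m1^'n, \<theta>2::complex^'m2^'n, x) s.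
    x *\<^sub>R (congr (flow \<alpha> (- 1 * (x * s))) (\<theta>1 ** cadj \<theta>1) + congr (flow \<alpha> (1 * (x * s))) (\<theta>2 ** cadj \<theta>2)))"
  have "continuous_on (UNIV \<times> cbox 0 1) (\<lambda>(p, s). f p s)"
    unfolding f_def case_prod_beta by (intro continuous_intros)
  then have "continuous_on UNIV (\<lambda>p. integral {0..1} (f p))"
    using integral_continuous_on_param by fastforce
  from continuous_on_tendsto_compose[OF this tendsto_Pair[OF lims(1) tendsto_Pair[OF lims(3) tendsto_Pair[OF lims(4) lims(5)]]]]
  have "(\<lambda>k. integral {0..1} (f (\<alpha> k, \<theta>1 k, \<theta>2 k, x k))) \<longlonglongrightarrow> integral {0..1} (f (\<alpha>0, \<tau>1, \<tau>2, y))"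
    by simp
  then have "(\<lambda>k. S0 k + integral {0..1} (f (\<alpha> k, \<theta>1 k, \<theta>2 k, x k))) \<longlonglongrightarrow> T0 + integral {0..1} (f (\<alpha>0, \<tau>1, \<tau>2, y))"
    by (intro tendsto_intros lims)
  moreover have "y \<ge> 0" using lims(5) x by (intro LIMSEQ_le_const) auto
  ultimately show ?thesis
    using node.S_eq_integral[OF nodes x] node.S_eq_integral[OF node0 \<open>y \<ge> 0\<close>] by (simp add: f_def)
qed

text \<open>The argument x moves together with the data: this joint convergence plays the role of
  uniform convergence on compact intervals.\<close>

lemma potential_tendsto:
  fixes \<alpha> :: "nat \<Rightarrow> complex^'n^'n" and \<theta>1 :: "nat \<Rightarrow> complex^'m1^'n" and \<theta>2 :: "nat \<Rightarrow> complex^'m2^'n"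
  assumes lims: "\<alpha> \<longlonglongrightarrow> \<alpha>0" "S0 \<longlonglongrightarrow> T0" "\<theta>1 \<longlonglongrightarrow> \<tau>1" "\<theta>2 \<longlonglongrightarrow> \<tau>2" "x \<longlonglongrightarrow> y"
    and x: "\<And>k. x k \<ge> 0"
    and nodes: "\<And>k. node (\<alpha> k) (S0 k) (\<theta>1 k) (\<theta>2 k) c" and node0: "node \<alpha>0 T0 \<tau>1 \<tau>2 c"
  shows "(\<lambda>k. pseudo_exp_potential (\<alpha> k) (S0 k) (\<theta>1 k) (\<theta>2 k) (x k))
    \<longlonglongrightarrow> pseudo_exp_potential \<alpha>0 T0 \<tau>1 \<tau>2 y"
proof -
  have "y \<ge> 0" using lims(5) x by (intro LIMSEQ_le_const) auto
  have "(\<lambda>k. matrix_inv (S_fun (\<alpha> k) (S0 k) (\<theta>1 k) (\<theta>2 k) (x k))) \<longlonglongrightarrow> matrix_inv (S_fun \<alpha>0 T0 \<tau>1 \<tau>2 y)"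
    by (rule tendsto_matrix_inv[OF S_fun_tendsto[OF assms] node.coercive_S[OF node0 \<open>y \<ge> 0\<close>] node.c_pos[OF node0]])
  then show ?thesis
    unfolding pseudo_exp_potential_def by (intro tendsto_intros lims)
qed

section \<open>Uniform convergence on the half-line\<close>

lemma opnorm_diff_le: "opnorm (M - N) \<le> opnorm M + opnorm N" for M :: "complex^'b^'a"
  unfolding opnorm_def[of "M - N"]
proof (rule onorm_le)
  fix w
  have "norm ((M - N) *v w) \<le> norm (M *v w) + norm (N *v w)"
    by (simp add: matrix_vector_mult_diff_rdistrib norm_triangle_ineq4)
  also have "\<dots> \<le> opnorm M * norm w + opnorm N * norm w"
    by (intro add_mono norm_mult_vec_le_opnorm)
  finally show "norm ((M - N) *v w) \<le> (opnorm M + opnorm N) * norm w"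
    by (simp add: distrib_right)
qed

lemma opnorm_bounded_of_convergent:
  fixes M :: "nat \<Rightarrow> complex^'b^'a"
  assumes "M \<longlonglongrightarrow> N"
  obtains b where "b > 0" "\<And>k. opnorm (M k) \<le> b" "opnorm N \<le> b"
proof -
  obtain K where K: "K > 0" "\<And>M::complex^'b^'a. opnorm M \<le> K * norm M"
    using opnorm_bound by blast
  obtain b where b: "b > 0" "\<And>k. norm (M k) \<le> b"
    using convergent_imp_Bseq[OF convergentI[OF assms]] by (auto elim: BseqE)
  have "norm N \<le> b"
    by (rule LIMSEQ_le_const2[OF tendsto_norm[OF assms]]) (use b(2) in auto)
  show thesis
  proof
    show "K * b > 0" using K(1) b(1) by simp
    show "opnorm (M k) \<le> K * b" for k
      using K b(2) by (meson order_trans mult_left_mono less_imp_le)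
    show "opnorm N \<le> K * b"
      using K \<open>norm N \<le> b\<close> by (meson order_trans mult_left_mono less_imp_le)
  qed
qed

lemma potential_small_tail:
  fixes \<alpha> :: "nat \<Rightarrow> complex^'n^'n" and \<theta>1 :: "nat \<Rightarrow> complex^'m1^'n" and \<theta>2 :: "nat \<Rightarrow> complex^'m2^'n"
  assumes lims: "\<alpha> \<longlonglongrightarrow> \<alpha>0" "S0 \<longlonglongrightarrow> T0" "\<theta>1 \<longlonglongrightarrow> \<tau>1" "\<theta>2 \<longlonglongrightarrow> \<tau>2"
    and nodes: "\<And>k. node (\<alpha> k) (S0 k) (\<theta>1 k) (\<theta>2 k) c" and node0: "node \<alpha>0 T0 \<tau>1 \<tau>2 c"
    and sp: "spectrum \<alpha>0 \<subseteq> {z. Im z \<le> 0}"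
    and ctrl: "\<And>\<mu> w. 0 \<le> Im \<mu> \<Longrightarrow> cadj \<alpha>0 *v w = \<mu> *s w \<Longrightarrow> cadj \<tau>2 *v w = 0 \<Longrightarrow> w = 0"
    and \<eta>: "\<eta> > 0"
  obtains T where
    "\<forall>\<^sub>F k in sequentially. \<forall>x\<ge>T. opnorm (pseudo_exp_potential (\<alpha> k) (S0 k) (\<theta>1 k) (\<theta>2 k) x) \<le> \<eta>"
    "\<forall>x\<ge>T. opnorm (pseudo_exp_potential \<alpha>0 T0 \<tau>1 \<tau>2 x) \<le> \<eta>"
proof -
  have c: "c > 0" using node.c_pos[OF node0] .
  obtain b1 where b1: "b1 > 0" "\<And>k. opnorm (\<theta>1 k) \<le> b1" "opnorm \<tau>1 \<le> b1"
    using opnorm_bounded_of_convergent[OF lims(3)] by blast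
  obtain b2 where b2: "b2 > 0" "\<And>k. opnorm (\<theta>2 k) \<le> b2" "opnorm \<tau>2 \<le> b2"
    using opnorm_bounded_of_convergent[OF lims(4)] by blast
  \<comment> \<open>Solves 2 b1 b2 / sqrt (K c) = \<eta>, the bound of
    \<open>potential_bound\<close> with both operator norms replaced by common bounds.\<close>
  define K where "K = (2 * b1 * b2 / \<eta>)\<^sup>2 / c"
  have K: "K > 0" using b1 b2 \<eta> c by (simp add: K_def)
  have sqrt_K: "sqrt (K * c) = 2 * b1 * b2 / \<eta>"
    using b1(1) b2(1) \<eta> c by (simp add: K_def)
  have bound: "2 * o1 * o2 / sqrt (K * c) \<le> \<eta>" if "o1 \<le> b1" "o2 \<le> b2" "0 \<le> o1" "0 \<le> o2" for o1 o2
  proof -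
    have "o1 * o2 \<le> b1 * b2" using that b1(1) by (intro mult_mono) auto
    then show ?thesis unfolding sqrt_K using b1(1) b2(1) \<eta> by (simp add: field_simps)
  qed
  \<comment> \<open>Twice K at the limit node leaves room for the loss in
    \<open>eventually_coercive\<close>.\<close>
  obtain T where T: "T \<ge> 0" "coercive (2 * K) (node.R \<alpha>0 T0 \<tau>1 \<tau>2 T)"
    by (rule node.R_unbounded[OF node0 sp ctrl])
  note R_eq = node.R_def[OF nodes] node.R_def[OF node0]
  have "(\<lambda>k. node.R (\<alpha> k) (S0 k) (\<theta>1 k) (\<theta>2 k) T) \<longlonglongrightarrow> node.R \<alpha>0 T0 \<tau>1 \<tau>2 T"
    unfolding R_eq
    by (intro tendsto_intros lims S_fun_tendsto[OF lims tendsto_const T(1) nodes node0])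
  from eventually_coercive[OF this T(2), of K] K
  have "\<forall>\<^sub>F k in sequentially. coercive K (node.R (\<alpha> k) (S0 k) (\<theta>1 k) (\<theta>2 k) T)" by simp
  then have 1: "\<forall>\<^sub>F k in sequentially. \<forall>x\<ge>T. opnorm (pseudo_exp_potential (\<alpha> k) (S0 k) (\<theta>1 k) (\<theta>2 k) x) \<le> \<eta>"
  proof eventually_elim
    case (elim k)
    show ?case
    proof (intro allI impI)
      fix x assume x: "T \<le> x"
      then have "0 \<le> x" using T(1) by simp
      from node.potential_bound[OF nodes this node.coercive_R_mono[OF nodes elim T(1) x] K]
      show "opnorm (pseudo_exp_potential (\<alpha> k) (S0 k) (\<theta>1 k) (\<theta>2 k) x) \<le> \<eta>"
        using bound[OF b1(2) b2(2) opnorm_nonneg opnorm_nonneg] by (rule order_trans)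
    qed
  qed
  have co: "coercive K (node.R \<alpha>0 T0 \<tau>1 \<tau>2 T)"
  proof -
    have "K * (norm w)\<^sup>2 \<le> 2 * K * (norm w)\<^sup>2" for w :: "complex^'n"
      using K by (intro mult_right_mono) auto
    then show ?thesis using T(2) unfolding coercive_def by (meson order_trans)
  qed
  have 2: "\<forall>x\<ge>T. opnorm (pseudo_exp_potential \<alpha>0 T0 \<tau>1 \<tau>2 x) \<le> \<eta>"
  proof (intro allI impI)
    fix x assume x: "T \<le> x"
    then have "0 \<le> x" using T(1) by simp
    from node.potential_bound[OF node0 this node.coercive_R_mono[OF node0 co T(1) x] K]
    show "opnorm (pseudo_exp_potential \<alpha>0 T0 \<tau>1 \<tau>2 x) \<le> \<eta>"
      using bound[OF b1(3) b2(3) opnorm_nonneg opnorm_nonneg] by (rule order_trans)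
  qed
  from that[OF 1 2] show thesis .
qed

text \<open>Points x_N where the potentials differ by \<epsilon> cannot lie in the common small
  tail, so they stay in a compact interval and accumulate at some y; there joint convergence
  contradicts the gap.\<close>

lemma potential_uniform_convergence:
  fixes \<alpha> :: "nat \<Rightarrow> complex^'n^'n" and \<theta>1 :: "nat \<Rightarrow> complex^'m1^'n" and \<theta>2 :: "nat \<Rightarrow> complex^'m2^'n"
  assumes lims: "\<alpha> \<longlonglongrightarrow> \<alpha>0" "S0 \<longlonglongrightarrow> T0" "\<theta>1 \<longlonglongrightarrow> \<tau>1" "\<theta>2 \<longlonglongrightarrow> \<tau>2"
    and nodes: "\<And>k. node (\<alpha> k) (S0 k) (\<theta>1 k) (\<theta>2 k) c" and node0: "node \<alpha>0 T0 \<tau>1 \<tau>2 c"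
    and sp: "spectrum \<alpha>0 \<subseteq> {z. Im z \<le> 0}"
    and ctrl: "\<And>\<mu> w. 0 \<le> Im \<mu> \<Longrightarrow> cadj \<alpha>0 *v w = \<mu> *s w \<Longrightarrow> cadj \<tau>2 *v w = 0 \<Longrightarrow> w = 0"
    and \<epsilon>: "\<epsilon> > 0"
  shows "\<forall>\<^sub>F k in sequentially. \<forall>x\<ge>0. opnorm (pseudo_exp_potential \<alpha>0 T0 \<tau>1 \<tau>2 x
    - pseudo_exp_potential (\<alpha> k) (S0 k) (\<theta>1 k) (\<theta>2 k) x) < \<epsilon>"
proof (rule ccontr)
  let ?v = "pseudo_exp_potential \<alpha>0 T0 \<tau>1 \<tau>2"
  let ?u = "\<lambda>k. pseudo_exp_potential (\<alpha> k) (S0 k) (\<theta>1 k) (\<theta>2 k)"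
  assume "\<not> ?thesis"
  then have "\<exists>k\<ge>N. \<exists>x\<ge>0. \<epsilon> \<le> opnorm (?v x - ?u k x)" for N
    unfolding eventually_sequentially by (meson not_le)
  then obtain q x where q: "\<And>N. q N \<ge> N" and x: "\<And>N. x N \<ge> 0"
    and far: "\<And>N. \<epsilon> \<le> opnorm (?v (x N) - ?u (q N) (x N))" by metis
  have q_lim: "filterlim q at_top sequentially"
    by (rule filterlim_at_top_mono[OF filterlim_ident]) (simp add: q)
  \<comment> \<open>Two tails of size \<epsilon>/4 add up to less than the gap \<epsilon>.\<close>
  obtain T where T: "\<forall>\<^sub>F k in sequentially. \<forall>x\<ge>T. opnorm (?u k x) \<le> \<epsilon> / 4" "\<forall>x\<ge>T. opnorm (?v x) \<le> \<epsilon> / 4"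
  proof (rule potential_small_tail[OF lims nodes node0 sp, where \<eta> = "\<epsilon> / 4"])
    show "w = 0" if "0 \<le> Im \<mu>" "cadj \<alpha>0 *v w = \<mu> *s w" "cadj \<tau>2 *v w = 0" for \<mu> w
      using ctrl that .
  qed (use \<epsilon> in simp_all)
  have "\<forall>\<^sub>F N in sequentially. x N \<in> {0..T}"
    using eventually_compose_filterlim[OF T(1) q_lim]
  proof eventually_elim
    case (elim N)
    show ?case
    proof (rule ccontr)
      assume "x N \<notin> {0..T}"
      then have "T \<le> x N" using x[of N] by simp
      then have "opnorm (?u (q N) (x N)) \<le> \<epsilon> / 4" "opnorm (?v (x N)) \<le> \<epsilon> / 4" using elim T(2) by auto
      then show False using far[of N] opnorm_diff_le[of "?v (x N)" "?u (q N) (x N)"] \<epsilon> by linarith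
    qed
  qed
  then obtain N0 where "\<And>N. x (N + N0) \<in> {0..T}"
    unfolding eventually_sequentially by (meson le_add2)
  then obtain y s where s: "strict_mono s" and y: "((\<lambda>N. x (N + N0)) \<circ> s) \<longlonglongrightarrow> y"
    using compact_Icc[of 0 T] unfolding compact_def by metis
  define p where "p = (\<lambda>j. s j + N0)"
  have "strict_mono p" using s by (simp add: p_def strict_mono_def)
  have qp: "filterlim (\<lambda>j. q (p j)) at_top sequentially"
    by (rule filterlim_compose[OF q_lim filterlim_subseq[OF \<open>strict_mono p\<close>]])
  have xp: "(\<lambda>j. x (p j)) \<longlonglongrightarrow> y" using y by (simp add: p_def o_def)
  have "(\<lambda>j. ?u (q (p j)) (x (p j))) \<longlonglongrightarrow> ?v y"
    by (rule potential_tendsto[OF lims[THEN filterlim_compose[OF _ qp]] xp x nodes node0])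
  \<comment> \<open>Continuity of the limit potential, obtained from the constant sequence of
    nodes.\<close>
  moreover have "(\<lambda>j. ?v (x (p j))) \<longlonglongrightarrow> ?v y"
    by (rule potential_tendsto[OF tendsto_const tendsto_const tendsto_const tendsto_const xp x node0 node0])
  ultimately have "(\<lambda>j. ?v (x (p j)) - ?u (q (p j)) (x (p j))) \<longlonglongrightarrow> ?v y - ?v y"
    by (intro tendsto_diff)
  then have "(\<lambda>j. opnorm (?v (x (p j)) - ?u (q (p j)) (x (p j)))) \<longlonglongrightarrow> 0"
    by (intro opnorm_tendsto_0) simp
  then have "\<epsilon> \<le> 0" by (rule LIMSEQ_le_const) (use far in auto)
  then show False using \<epsilon> by simp
qed

section \<open>Stability of the recovery procedure\<close>

abbreviation recovered_alpha where
  "recovered_alpha A B X \<equiv> A + \<i> *\<^sub>C (B ** cadj B ** X)"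

abbreviation recovered_theta2 where
  "recovered_theta2 C X \<equiv> (- \<i>) *\<^sub>C (matrix_inv X ** cadj C)"

lemma selected_solution_invertible:
  assumes "selected_solution A B C X"
  shows "invertible X"
  using assms pos_def_coercive[of X] coercive_invertible
  unfolding selected_solution_def by metis

text \<open>The feedback term in alpha cancels the quadratic term of the Riccati equation. This
  linear form underlies both the node identity and
  \<open>selected_solution_controllable\<close>.\<close>

lemma selected_solution_cadj_alpha:
  assumes "selected_solution A B C X"
  shows "cadj (recovered_alpha A B X) ** X = X ** A + \<i> *\<^sub>C (cadj C ** C)"
proof -
  have h: "cadj X = X" and ric: "riccati_solution A B C X"
    using assms by (auto simp: selected_solution_def pos_def_def hermitian_def)
  show ?thesis
    by (simp add: cadj_add cadj_smul cadj_mult h matrix_mult_diff_left smul_mult_left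
        matrix_mul_assoc riccati_solution_cadj[OF ric] smul_minus_left)
qed

text \<open>Multiplying the previous identity by the inverse of X on both sides gives the node
  identity; an upper bound K for X becomes the constant 1/K.\<close>

lemma selected_solution_node:
  assumes sel: "selected_solution A B C X" and K: "opnorm X \<le> K" "K > 0"
  shows "node (recovered_alpha A B X) (matrix_inv X) B (recovered_theta2 C X) (1 / K)"
proof
  let ?Z = "matrix_inv X" and ?a = "recovered_alpha A B X"
  have inv: "invertible X" using selected_solution_invertible[OF sel] .
  have h: "hermitian X" using sel by (simp add: selected_solution_def pos_def_def)
  show hZ: "hermitian ?Z" by (rule hermitian_matrix_inv[OF inv h])
  obtain d where "d > 0" "coercive d X"
    using sel pos_def_coercive[of X] unfolding selected_solution_def by metis
  then show "coercive (1 / K) ?Z" using coercive_matrix_inv[OF h _ _ K] by blast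
  show "0 < 1 / K" using K by simp
  have hZ': "cadj ?Z = ?Z" using hZ by (simp add: hermitian_def)
  have "?Z ** cadj ?a = ?Z ** (cadj ?a ** X) ** ?Z"
    by (simp add: matrix_inv_mult[OF inv] flip: matrix_mul_assoc)
  also have "\<dots> = (?Z ** X) ** A ** ?Z + \<i> *\<^sub>C (?Z ** cadj C ** C ** ?Z)"
    unfolding selected_solution_cadj_alpha[OF sel]
    by (simp add: matrix_mult_add_left matrix_mult_add_right smul_mult_left smul_mult_right matrix_mul_assoc)
  finally have Za: "?Z ** cadj ?a = A ** ?Z + \<i> *\<^sub>C (?Z ** cadj C ** C ** ?Z)"
    by (simp add: matrix_inv_mult[OF inv])
  have "?a ** ?Z = A ** ?Z + \<i> *\<^sub>C (B ** cadj B ** (X ** ?Z))"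
    by (simp add: matrix_mult_add_left smul_mult_left matrix_mul_assoc)
  then have aZ: "?a ** ?Z = A ** ?Z + \<i> *\<^sub>C (B ** cadj B)"
    by (simp add: matrix_inv_mult[OF inv])
  show "?a ** ?Z - ?Z ** cadj ?a = \<i> *\<^sub>C (B ** cadj B - recovered_theta2 C X ** cadj (recovered_theta2 C X))"
    unfolding Za aZ
    by (simp only: cadj_smul cadj_mult hZ' smul_mult_left smul_mult_right smul_diff cadj_cadj matrix_mul_assoc)
      simp
qed

text \<open>For y = X^(-1) w the last hypothesis says C y = 0, so the adjoint of alpha sends w to X
  A y. Hence A y = \<mu> y, while A has no eigenvalue in the closed upper half-plane.\<close>

lemma selected_solution_controllable:
  assumes sel: "selected_solution A B C X" and G: "(A, B, C) \<in> class_G"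
    and im: "0 \<le> Im \<mu>" and ev: "cadj (recovered_alpha A B X) *v w = \<mu> *s w"
    and w: "cadj (recovered_theta2 C X) *v w = 0"
  shows "w = 0"
proof -
  let ?y = "matrix_inv X *v w"
  have inv: "invertible X" using selected_solution_invertible[OF sel] .
  have "hermitian X" using sel by (simp add: selected_solution_def pos_def_def)
  then have hZ: "cadj (matrix_inv X) = matrix_inv X"
    using hermitian_matrix_inv[OF inv] by (simp add: hermitian_def)
  have wy: "X *v ?y = w" by (simp add: matrix_vector_mul_assoc matrix_inv_mult[OF inv])
  have "\<i> *s (C *v ?y) = 0"
    using w by (simp add: cadj_smul cadj_mult hZ smul_mult_vec matrix_vector_mul_assoc)
  then have Cy: "C *v ?y = 0" by simp
  have "\<mu> *s w = (cadj (recovered_alpha A B X) ** X) *v ?y"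
    using ev by (simp add: wy flip: matrix_vector_mul_assoc)
  also have "\<dots> = X *v (A *v ?y)"
    unfolding selected_solution_cadj_alpha[OF sel]
    by (simp only: matrix_vector_mult_add_rdistrib smul_mult_vec matrix_vector_mul_assoc[symmetric] Cy) simp
  finally have "matrix_inv X *v (\<mu> *s w) = matrix_inv X *v (X *v (A *v ?y))" by simp
  then have "A *v ?y = \<mu> *s ?y"
    by (simp add: mult_vec_cscale matrix_vector_mul_assoc[of "matrix_inv X" X] matrix_inv_mult[OF inv])
  moreover have "\<mu> \<notin> spectrum A"
    using G im by (auto simp: class_G_def complex_is_Real_iff le_less)
  ultimately have "?y = 0" using spectrum_iff_eigenvector by blast
  then show "w = 0" using wy by simp
qed

lemma recovered_potential_uniform_convergence:
  fixes A :: "nat \<Rightarrow> complex^'n^'n" and B :: "nat \<Rightarrow> complex^'m1^'n" and C :: "nat \<Rightarrow> complex^'n^'m2"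
  assumes lims: "A \<longlonglongrightarrow> A0" "B \<longlonglongrightarrow> B0" "C \<longlonglongrightarrow> C0" "X \<longlonglongrightarrow> X0"
    and G: "(A0, B0, C0) \<in> class_G" and sel0: "selected_solution A0 B0 C0 X0"
    and sel: "\<And>k. selected_solution (A k) (B k) (C k) (X k)" and \<epsilon>: "\<epsilon> > 0"
  shows "\<forall>\<^sub>F k in sequentially. \<forall>x\<ge>0. opnorm
    (pseudo_exp_potential (recovered_alpha A0 B0 X0) (matrix_inv X0) B0 (recovered_theta2 C0 X0) x
    - pseudo_exp_potential (recovered_alpha (A k) (B k) (X k)) (matrix_inv (X k)) (B k)
      (recovered_theta2 (C k) (X k)) x) < \<epsilon>"
proof -
  obtain K where K: "K > 0" "\<And>k. opnorm (X k) \<le> K" "opnorm X0 \<le> K"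
    using opnorm_bounded_of_convergent[OF lims(4)] by blast
  obtain d where d: "d > 0" "coercive d X0"
    using sel0 pos_def_coercive[of X0] unfolding selected_solution_def by metis
  have inv_lim: "(\<lambda>k. matrix_inv (X k)) \<longlonglongrightarrow> matrix_inv X0"
    by (rule tendsto_matrix_inv[OF lims(4) d(2,1)])
  show ?thesis
  proof (rule potential_uniform_convergence[where c = "1 / K"])
    show "spectrum (recovered_alpha A0 B0 X0) \<subseteq> {z. Im z \<le> 0}"
      using sel0 by (auto simp: selected_solution_def complex_is_Real_iff)
    show "node (recovered_alpha (A k) (B k) (X k)) (matrix_inv (X k)) (B k) (recovered_theta2 (C k) (X k)) (1 / K)"
      for k by (rule selected_solution_node[OF sel K(2) K(1)])
    show "node (recovered_alpha A0 B0 X0) (matrix_inv X0) B0 (recovered_theta2 C0 X0) (1 / K)"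
      by (rule selected_solution_node[OF sel0 K(3) K(1)])
    show "w = 0" if "0 \<le> Im \<mu>" "cadj (recovered_alpha A0 B0 X0) *v w = \<mu> *s w"
      "cadj (recovered_theta2 C0 X0) *v w = 0" for \<mu> w
      using selected_solution_controllable[OF sel0 G] that .
  qed (intro tendsto_intros lims inv_lim \<epsilon>)+
qed

theorem theorem3p9:
  fixes A :: "complex^'n^'n" and B :: "complex^'m1^'n" and C :: "complex^'n^'m2"
    and v :: "real \<Rightarrow> complex^'m2^'m1"
  assumes "(A, B, C) \<in> class_G"
    and "recovered_potential A B C v"
  shows "\<forall>\<epsilon>>0. \<exists>\<delta>>0. \<forall>(A' :: complex^'n^'n) (B' :: complex^'m1^'n) (C' :: complex^'n^'m2) v'.
    (A', B', C') \<in> class_G \<longrightarrow>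
    opnorm (A - A') + opnorm (B - B') + opnorm (C - C') < \<delta> \<longrightarrow>
    recovered_potential A' B' C' v' \<longrightarrow>
    (SUP x\<in>{0..}. ereal (opnorm (v x - v' x))) < ereal \<epsilon>"
proof (intro allI impI, rule ccontr)
  fix \<epsilon> :: real
  assume \<epsilon>: "\<epsilon> > 0"
  let ?far = "\<lambda>v'. \<not> (SUP x\<in>{0..}. ereal (opnorm (v x - v' x))) < ereal \<epsilon>"
  assume no: "\<not> (\<exists>\<delta>>0. \<forall>(A' :: complex^'n^'n) (B' :: complex^'m1^'n) (C' :: complex^'n^'m2) v'.
    (A', B', C') \<in> class_G \<longrightarrow>
    opnorm (A - A') + opnorm (B - B') + opnorm (C - C') < \<delta> \<longrightarrow>
    recovered_potential A' B' C' v' \<longrightarrow>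
    (SUP x\<in>{0..}. ereal (opnorm (v x - v' x))) < ereal \<epsilon>)"
  \<comment> \<open>A counterexample for \<delta> = 1/(k+1), packed into one tuple so that a single
    choice produces all four sequences.\<close>
  define Q where "Q = (\<lambda>k (A' :: complex^'n^'n, B' :: complex^'m1^'n, C' :: complex^'n^'m2, v').
      opnorm (A - A') + opnorm (B - B') + opnorm (C - C') < 1 / real (Suc k) \<and>
      recovered_potential A' B' C' v' \<and> ?far v')"
  have "\<exists>p. Q k p" for k
  proof -
    have "0 < 1 / real (Suc k)" by simp
    with no show ?thesis unfolding Q_def by blast
  qed
  then obtain p where p: "\<And>k. Q k (p k)" by metis
  define A' B' C' v' where "A' = (\<lambda>k. fst (p k))" and "B' = (\<lambda>k. fst (snd (p k)))"
    and "C' = (\<lambda>k. fst (snd (snd (p k))))" and "v' = (\<lambda>k. snd (snd (snd (p k))))"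
  have close: "opnorm (A - A' k) + opnorm (B - B' k) + opnorm (C - C' k) < 1 / real (Suc k)"
    and rec: "recovered_potential (A' k) (B' k) (C' k) (v' k)" and far: "?far (v' k)" for k
    using p[of k] unfolding Q_def A'_def B'_def C'_def v'_def case_prod_beta by blast+
  have lim0: "f \<longlonglongrightarrow> 0" if "\<And>k. 0 \<le> f k" "\<And>k. f k \<le> 1 / real (Suc k)" for f :: "nat \<Rightarrow> real"
    by (rule tendsto_sandwich[OF _ _ tendsto_const LIMSEQ_Suc[OF lim_1_over_n]]) (use that in auto)
  have bounds: "opnorm (A - A' k) \<le> 1 / real (Suc k)" "opnorm (B - B' k) \<le> 1 / real (Suc k)"
    "opnorm (C - C' k) \<le> 1 / real (Suc k)" for k
    using close[of k] opnorm_nonneg[of "A - A' k"] opnorm_nonneg[of "B - B' k"] opnorm_nonneg[of "C - C' k"]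
    by linarith+
  have lims: "A' \<longlonglongrightarrow> A" "B' \<longlonglongrightarrow> B" "C' \<longlonglongrightarrow> C"
    by (rule tendsto_of_opnorm_diff, rule lim0, rule opnorm_nonneg, rule bounds)+
  obtain X where sel: "selected_solution A B C X" and v: "\<And>x. x \<ge> 0 \<Longrightarrow> v x =
      pseudo_exp_potential (recovered_alpha A B X) (matrix_inv X) B (recovered_theta2 C X) x"
    using assms(2) unfolding recovered_potential_def by blast
  obtain X' where sel': "\<And>k. selected_solution (A' k) (B' k) (C' k) (X' k)"
    and v': "\<And>k x. x \<ge> 0 \<Longrightarrow> v' k x = pseudo_exp_potential (recovered_alpha (A' k) (B' k) (X' k))
      (matrix_inv (X' k)) (B' k) (recovered_theta2 (C' k) (X' k)) x"
    using rec unfolding recovered_potential_def by metis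
  obtain r where r: "strict_mono r" and X: "(X' \<circ> r) \<longlonglongrightarrow> X"
    using selected_solution_subsequence[OF lims assms(1) sel sel'] by blast
  \<comment> \<open>A supremum of values below \<epsilon> may equal \<epsilon>; aiming at
    \<epsilon>/2 keeps the final inequality strict.\<close>
  have "\<epsilon> / 2 > 0" using \<epsilon> by simp
  from recovered_potential_uniform_convergence[OF lims[THEN LIMSEQ_subseq_LIMSEQ[OF _ r]] X assms(1) sel _ this]
  have "\<forall>\<^sub>F k in sequentially. \<forall>x\<ge>0. opnorm (v x - v' (r k) x) < \<epsilon> / 2"
    using sel' by (simp add: v v')
  then obtain k where k: "\<And>x. x \<ge> 0 \<Longrightarrow> opnorm (v x - v' (r k) x) < \<epsilon> / 2"
    unfolding eventually_sequentially by blast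
  have "(SUP x\<in>{0..}. ereal (opnorm (v x - v' (r k) x))) \<le> ereal (\<epsilon> / 2)"
    by (rule SUP_least) (use k in \<open>auto intro: less_imp_le\<close>)
  also have "\<dots> < ereal \<epsilon>" using \<epsilon> by simp
  finally show False using far[of "r k"] by blast
qed

end
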